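(* For any $k\ge1$ and any meander $C$ of size $k$, we have $$\mathbb P(S_0=C)=2^{-4k+1}\,k\sum_{\ell_0,\dots,\ell_{2k-2}\ge0}\ \left(\prod_{F\in\mathcal F(C)}\mathrm{Cat}_{\ell_{I(F)}}\,2^{-2\ell_{I(F)}}\right),$$ where, for a set $I$ of indices, $\ell_I=\sum_{i\in I}\ell_i$.
   Context: Infinite noodle: let $\boldsymbol w^a_\infty,\boldsymbol w^b_\infty\in\{L,R\}^{\mathbb Z}$ be two independent random words with i.i.d. uniform letters in $\{L,R\}$. Almost surely there is a unique non-crossing partition of $\mathbb Z$ into pairs (no two pairs $\{i,k\},\{j,\ell\}$ with $i<j<k<\ell$) such that, for all $i$, $i$ is the smaller element of its pair iff $\boldsymbol w^a_\infty(i)=L$ (upper matching), and similarly for $\boldsymbol w^b_\infty$ (lower matching). The infinite noodle $\boldsymbol M_\infty$ is the (multi-)graph on $\mathbb Z$ with edges the pairs of both matchings; $C_0(\boldsymbol M_\infty)$ is the connected component of $0$. Meanders: a meandric system of size $k$ is an ordered pair (upper, lower) of non-crossing perfect matchings of $\{0,\dots,2k-1\}$; it is a meander if the multigraph formed by the pairs of both matchings is connected. A non-crossing perfect matching is encoded by the word $w\in\{L,R\}^{\{0,\dots,2k-1\}}$ with $w(i)=L$ iff $i$ is the smaller element of its pair. Shape: let $E\subset\mathbb Z$ be the set of points of $C_0(\boldsymbol M_\infty)$. If $E$ is finite, let $g:E\to\{0,\dots,|E|-1\}$ be the unique increasing bijection; the shape $S_0$ is the meandric system of size $|E|/2$ whose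 upper and lower words are $\boldsymbol w^a(i)=\boldsymbol w^a_\infty(g^{-1}(i))$ and $\boldsymbol w^b(i)=\boldsymbol w^b_\infty(g^{-1}(i))$, $0\le i\le|E|-1$; it is a meander. The event $\{S_0=C\}$ includes that $E$ is finite. Faces: draw the pairs of the upper (lower) matching of $C$ as non-crossing arcs above (below) the real axis. The set $\mathcal F(C)$ of faces is the set of bounded connected components of the complement of the union of these arcs and the real axis. For a face $F$, $I(F)$ is the set of indices $i\in\{0,\dots,2k-2\}$ such that $F$ is incident to the segment $[i;i+1]$. (Equivalently, faces correspond to the arcs: the face of an arc $\{a<b\}$ has $I(F)=\{i: a\le i<b$ and there is no other arc $\{c<d\}$ of the same matching with $a<c\le i<d<b\}$.) $\mathrm{Cat}_n=\frac1{n+1}\binom{2n}n$. *)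

theory Defs
  imports "HOL-Probability.Probability"
begin

datatype letter = L | R

text \<open>The matching notions are polymorphic, so that the same definitions serve the infinite noodle
  (ground set \<open>UNIV :: int set\<close>) and meandric systems (ground set \<open>{0..<2 * k}\<close>). A matching is
  the set of its (unordered) pairs.\<close>

definition noncrossing_matching :: "'a::linorder set \<Rightarrow> 'a set set \<Rightarrow> bool" where
  "noncrossing_matching A P \<longleftrightarrow>
     partition_on A P \<and> (\<forall>p\<in>P. card p = 2) \<and>
     \<not> (\<exists>i j k l. i < j \<and> j < k \<and> k < l \<and> {i, k} \<in> P \<and> {j, l} \<in> P)"

definition encodes :: "'a::linorder set \<Rightarrow> ('a \<Rightarrow> letter) \<Rightarrow> 'a set set \<Rightarrow> bool" where
  "encodes A w P \<longleftrightarrow> (\<forall>i\<in>A. w i = L \<longleftrightarrow> (\<exists>j. i < j \<and> {i, j} \<in> P))"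

text \<open>Edge multiplicities of the multigraph are irrelevant for its connected components.\<close>

definition adjacent :: "'a set set \<Rightarrow> 'a set set \<Rightarrow> 'a \<Rightarrow> 'a \<Rightarrow> bool" where
  "adjacent P Q x y \<longleftrightarrow> {x, y} \<in> P \<or> {x, y} \<in> Q"

definition graph_component :: "'a set set \<Rightarrow> 'a set set \<Rightarrow> 'a \<Rightarrow> 'a set" where
  "graph_component P Q x = {y. (adjacent P Q)\<^sup>*\<^sup>* x y}"

definition meandric_system :: "nat \<Rightarrow> nat set set \<times> nat set set \<Rightarrow> bool" where
  "meandric_system k C \<longleftrightarrow>
     noncrossing_matching {0..<2 * k} (fst C) \<and> noncrossing_matching {0..<2 * k} (snd C)"

definition meander :: "nat \<Rightarrow> nat set set \<times> nat set set \<Rightarrow> bool" where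
  "meander k C \<longleftrightarrow> meandric_system k C \<and>
     (\<forall>x\<in>{0..<2 * k}. \<forall>y\<in>{0..<2 * k}. y \<in> graph_component (fst C) (snd C) x)"

text \<open>\<open>noodle_shape wa wb C\<close> is the event that the shape of the component of \<open>0\<close> is \<open>C\<close>. It includes
  the existence of the two infinite matchings, which may fail on a null set of words (when they
  exist, they are unique), and the finiteness of the component. A finite matching is determined by
  its word, hence at most one \<open>C\<close> satisfies this.\<close>

definition noodle_shape ::
  "(int \<Rightarrow> letter) \<Rightarrow> (int \<Rightarrow> letter) \<Rightarrow> nat set set \<times> nat set set \<Rightarrow> bool" where
  "noodle_shape wa wb C \<longleftrightarrow>
     (\<exists>P Q E g.
        noncrossing_matching UNIV P \<and> encodes UNIV wa P \<and>
        noncrossing_matching UNIV Q \<and> encodes UNIV wb Q \<and>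
        E = graph_component P Q 0 \<and> finite E \<and>
        bij_betw g E {0..<card E} \<and> strict_mono_on E g \<and>
        meandric_system (card E div 2) C \<and>
        encodes {0..<card E} (\<lambda>i. wa (inv_into E g i)) (fst C) \<and>
        encodes {0..<card E} (\<lambda>i. wb (inv_into E g i)) (snd C))"

text \<open>The arcs are drawn in the complex plane as half-circles having as diameter the segment between
  the two points of a pair.\<close>

definition upper_arc :: "nat \<Rightarrow> nat \<Rightarrow> complex set" where
  "upper_arc a b = {z. Im z \<ge> 0 \<and> cmod (z - (of_nat a + of_nat b) / 2) = \<bar>real b - real a\<bar> / 2}"

definition lower_arc :: "nat \<Rightarrow> nat \<Rightarrow> complex set" where
  "lower_arc a b = {z. Im z \<le> 0 \<and> cmod (z - (of_nat a + of_nat b) / 2) = \<bar>real b - real a\<bar> / 2}"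

definition drawing :: "nat set set \<times> nat set set \<Rightarrow> complex set" where
  "drawing C = \<real> \<union> \<Union> {upper_arc a b | a b. {a, b} \<in> fst C} \<union> \<Union> {lower_arc a b | a b. {a, b} \<in> snd C}"

definition faces :: "nat set set \<times> nat set set \<Rightarrow> complex set set" where
  "faces C = {F \<in> components (- drawing C). bounded F}"

definition face_indices :: "nat \<Rightarrow> complex set \<Rightarrow> nat set" where
  "face_indices k F =
     {i \<in> {0..2 * k - 2}. closed_segment (of_nat i) (of_nat (i + 1)) \<subseteq> frontier F}"

definition catalan :: "nat \<Rightarrow> real" where
  "catalan n = 1 / real (n + 1) * real ((2 * n) choose n)"

definition face_weight :: "nat \<Rightarrow> nat set set \<times> nat set set \<Rightarrow> (nat \<Rightarrow> nat) \<Rightarrow> real" where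
  "face_weight k C l =
     (\<Prod>F\<in>faces C. let n = (\<Sum>i\<in>face_indices k F. l i) in catalan n * 2 powi (- 2 * int n))"

end

theory Submission imports Defs begin

text \<open>
  In a noncrossing matching of the line the letters from one end of a pair to the other form a
  first excursion of the walk with steps \<open>+1\<close> for \<open>L\<close> and \<open>-1\<close> for \<open>R\<close>, and conversely; so
  everything can be read off from excursions of the words.

  Fix the embedding \<open>f\<close> of the \<open>2k\<close> points of \<open>C\<close>, with \<open>f m = 0\<close>. It realises \<open>C\<close> as the component
  of \<open>0\<close> iff every arc \<open>(a, b)\<close> of \<open>C\<close> becomes an excursion on \<open>{f a..f b}\<close>. Removing the nested
  excursions from such an interval, this is equivalent to each face of \<open>C\<close> carrying an excursion on its
  own points. These sets of points are disjoint, hence the events are independent, and a face with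
  \<open>2n + 2\<close> points contributes \<open>Cat\<^sub>n / 2\<^bsup>2n + 2\<^esup>\<close>. The gaps of \<open>f\<close> are
  necessarily even: an arc always joins points of opposite parity, both in \<open>C\<close> and in the noodle, so that
  \<open>f i - i\<close> has constant parity along the connected meander. Summing over the gaps and over the
  \<open>2k\<close> choices of \<open>m\<close> gives the formula. That almost every word has a matching follows from
  \<open>\<Sum>\<^sub>n Cat\<^sub>n / 2\<^bsup>2n + 2\<^esup> = 1/2\<close>, the probability of a given letter.
\<close>

section \<open>Excursions and the ballot numbers\<close>

text \<open>The constant of the formula collects two counts. Each matching has \<open>k\<close>
  arcs, so there are \<open>2k\<close> faces, and writing \<open>Cat_n / 2^(2n+2)\<close> as
  \<open>Cat_n 4^(-n) / 4\<close> leaves a factor \<open>16^(-k)\<close>; the probability of a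
  realisation does not depend on \<open>m\<close>, so that the prefactor is
  \<open>2k / 16^k = 2^(1-4k) k\<close>. Two obstacles shape the proof. The faces are given
  topologically, as bounded components, and must first be identified with the arcs. The shape event
  speaks of infinite matchings, for which neither measurability nor independence is visible, so it
  is replaced by conditions on finite windows of the words. Different choices of \<open>m\<close>
  and of the gaps exclude each other because every realisation has the component of 0 as its image.
  This argument uses the matchings, hence all events are intersected with the almost sure event that
  both words have one. Convergence of the series then comes for free, its terms being multiples of
  probabilities of disjoint events.\<close>

definition step :: "letter \<Rightarrow> int" where
  "step c = (case c of L \<Rightarrow> 1 | R \<Rightarrow> -1)"

lemma step_simps [simp]: "step L = 1" "step R = -1"
  by (simp_all add: step_def)

lemma UNIV_letter: "(UNIV :: letter set) = {L, R}"
  using letter.exhaust by auto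

instance letter :: finite
  by standard (simp add: UNIV_letter)

text \<open>For positive \<open>h\<close> this is a first passage: the walk started at height
  \<open>h\<close> and read along \<open>A\<close> in increasing order reaches 0 only with its last
  letter. \<open>A\<close> is an arbitrary set and not an interval, since words are later read along
  the scattered points of a face; the starting height is what changes when the smallest point is
  removed.\<close>

definition passage :: "int \<Rightarrow> ('a::linorder \<Rightarrow> letter) \<Rightarrow> 'a set \<Rightarrow> bool" where
  "passage h w A \<longleftrightarrow> h + (\<Sum>x\<in>A. step (w x)) = 0 \<and>
     (\<forall>t\<in>A. (\<exists>u\<in>A. t < u) \<longrightarrow> 0 < h + (\<Sum>x\<in>{x\<in>A. x \<le> t}. step (w x)))"

text \<open>Positivity is strict before the end, so this is an irreducible Dyck word (a first return
  to 0). The empty walk has to be excluded by hand, as it satisfies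
  \<open>passage 0\<close>.\<close>

definition excursion :: "('a::linorder \<Rightarrow> letter) \<Rightarrow> 'a set \<Rightarrow> bool" where
  "excursion w A \<longleftrightarrow> A \<noteq> {} \<and> passage 0 w A"

lemma passage_cong: "(\<And>x. x \<in> A \<Longrightarrow> w x = w' x) \<Longrightarrow> passage h w A \<longleftrightarrow> passage h w' A"
  unfolding passage_def by (simp cong: conj_cong)

lemma excursion_cong: "(\<And>x. x \<in> A \<Longrightarrow> w x = w' x) \<Longrightarrow> excursion w A \<longleftrightarrow> excursion w' A"
  unfolding excursion_def using passage_cong[of A w w'] by simp

lemma passage_empty [simp]: "passage h w {} \<longleftrightarrow> h = 0"
  by (simp add: passage_def)

text \<open>Reading the first letter moves the starting height. The height after it must be positive
  only if letters remain, whence the case \<open>A = {}\<close>.\<close>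

lemma passage_insert:
  assumes "finite A" "\<And>a. a \<in> A \<Longrightarrow> b < a"
  shows "passage h w (insert b A) \<longleftrightarrow>
    (A = {} \<or> 0 < h + step (w b)) \<and> passage (h + step (w b)) w A"
proof -
  have b: "b \<notin> A" using assms(2) by auto
  have 1: "{x \<in> insert b A. x \<le> t} = insert b {x\<in>A. x \<le> t}" if "t \<in> A" for t
    using assms(2)[OF that] by auto
  have 2: "{x \<in> insert b A. x \<le> b} = {b}" using assms(2) by force
  have 3: "(\<exists>u\<in>insert b A. b < u) \<longleftrightarrow> A \<noteq> {}" using assms(2) by auto
  have 4: "(\<exists>u\<in>insert b A. t < u) \<longleftrightarrow> (\<exists>u\<in>A. t < u)" if "t \<in> A" for t
    using assms(2)[OF that] by auto
  have 5: "(\<Sum>x\<in>{x \<in> insert b A. x \<le> t}. step (w x)) = step (w b) + (\<Sum>x\<in>{x\<in>A. x \<le> t}. step (w x))"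
    if "t \<in> A" for t
    using 1[OF that] assms(1) b by simp
  let ?sum = "\<lambda>B t. \<Sum>x\<in>{x \<in> B. x \<le> t}. step (w x)"
  have "(\<forall>t\<in>insert b A. (\<exists>u\<in>insert b A. t < u) \<longrightarrow> 0 < h + ?sum (insert b A) t) \<longleftrightarrow>
      ((\<exists>u\<in>insert b A. b < u) \<longrightarrow> 0 < h + ?sum (insert b A) b) \<and>
      (\<forall>t\<in>A. (\<exists>u\<in>insert b A. t < u) \<longrightarrow> 0 < h + ?sum (insert b A) t)"
    by (rule ball_insert)
  also have "\<dots> \<longleftrightarrow> (A = {} \<or> 0 < h + step (w b)) \<and>
      (\<forall>t\<in>A. (\<exists>u\<in>A. t < u) \<longrightarrow> 0 < h + step (w b) + ?sum A t)"
  proof (rule arg_cong2[where f = "(\<and>)"])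
    show "((\<exists>u\<in>insert b A. b < u) \<longrightarrow> 0 < h + ?sum (insert b A) b) \<longleftrightarrow> (A = {} \<or> 0 < h + step (w b))"
      unfolding 2 3 by auto
    show "(\<forall>t\<in>A. (\<exists>u\<in>insert b A. t < u) \<longrightarrow> 0 < h + ?sum (insert b A) t) \<longleftrightarrow>
      (\<forall>t\<in>A. (\<exists>u\<in>A. t < u) \<longrightarrow> 0 < h + step (w b) + ?sum A t)"
      by (rule ball_cong[OF refl]) (simp only: 4 5 add.assoc)
  qed
  finally show ?thesis
    unfolding passage_def using assms(1) b by (simp add: conj_ac add.assoc)
qed

lemma even_card_if_sum_step_eq_0:
  assumes "finite A" "(\<Sum>x\<in>A. step (w x)) = 0"
  shows "even (card A)"
proof -
  have "even ((\<Sum>x\<in>A. step (w x)) + int (card A))" using assms(1)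
    by (induction rule: finite_induct) (auto simp: step_def split: letter.splits)
  then show ?thesis using assms(2) by simp
qed

lemma card_words_insert:
  assumes "finite A" "b \<notin> A"
  shows "card {w \<in> insert b A \<rightarrow>\<^sub>E (UNIV :: 'c::finite set). Q w} =
    (\<Sum>c\<in>UNIV. card {w \<in> A \<rightarrow>\<^sub>E UNIV. Q (w(b := c))})"
proof -
  have eq: "{w \<in> insert b A \<rightarrow>\<^sub>E (UNIV :: 'c set). Q w} =
      (\<Union>c\<in>UNIV. (\<lambda>w. w(b := c)) ` {w \<in> A \<rightarrow>\<^sub>E UNIV. Q (w(b := c))})" (is "?X = ?Y")
  proof (intro subset_antisym subsetI)
    fix w assume w: "w \<in> ?X"
    then have "w \<in> (\<lambda>(c, v). v(b := c)) ` (UNIV \<times> (A \<rightarrow>\<^sub>E UNIV))" by (simp add: PiE_insert_eq)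
    then obtain c v where "w = v(b := c)" "v \<in> A \<rightarrow>\<^sub>E UNIV" by auto
    with w have "w \<in> (\<lambda>v. v(b := c)) ` {v \<in> A \<rightarrow>\<^sub>E UNIV. Q (v(b := c))}" by blast
    then show "w \<in> ?Y" by blast
  next
    fix w assume "w \<in> ?Y"
    then obtain c v where "w = v(b := c)" "v \<in> A \<rightarrow>\<^sub>E UNIV" "Q w" by blast
    then show "w \<in> ?X" by (auto simp: PiE_insert_eq)
  qed
  have inj: "inj_on (\<lambda>w. w(b := c)) {w \<in> A \<rightarrow>\<^sub>E UNIV. Q (w(b := c))}" for c :: 'c
  proof (rule inj_onI)
    fix v w assume *: "v \<in> {w \<in> A \<rightarrow>\<^sub>E UNIV. Q (w(b := c))}" "w \<in> {w \<in> A \<rightarrow>\<^sub>E UNIV. Q (w(b := c))}"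
      "v(b := c) = w(b := c)"
    then have "v b = undefined" "w b = undefined" using assms(2) by (auto simp: PiE_def extensional_def)
    then show "v = w" using *(3) by (metis fun_upd_triv fun_upd_upd)
  qed
  have fin: "finite {w \<in> A \<rightarrow>\<^sub>E (UNIV :: 'c set). P w}" for P
    by (rule finite_subset[OF _ finite_PiE[OF assms(1)]]) auto
  show ?thesis unfolding eq
    by (subst card_UN_disjoint) (auto simp: card_image[OF inj] fin, metis fun_upd_same)
qed

section \<open>Ballot numbers and the number of excursions of given length\<close>

text \<open>Number of walks with \<open>j\<close> up-steps from \<open>h\<close> that first hit 0 at
  time \<open>h + 2 * j\<close>. The last step is forced to go down from 1; among the other
  \<open>h + 2 * j - 1\<close> steps the reflection principle subtracts the walks that touch 0. The
  case \<open>j = 0\<close> is separate because \<open>j - 1\<close> is truncated.\<close>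

definition ballot :: "nat \<Rightarrow> nat \<Rightarrow> int" where
  "ballot h j = int ((h + 2 * j - 1) choose j) -
     (if j = 0 then 0 else int ((h + 2 * j - 1) choose (j - 1)))"

text \<open>Boundary value of the recursion: a walk that has come down to 0 counts only if no letter
  remains.\<close>

lemma ballot_0: "ballot 0 j = (if j = 0 then 1 else 0)"
proof (cases j)
  case (Suc i)
  then show ?thesis
    using binomial_symmetric[of i "Suc (2 * i)"] by (simp add: ballot_def)
qed (simp add: ballot_def)

lemma ballot_j0: "ballot h 0 = 1"
  by (simp add: ballot_def)

text \<open>Pascal's rule in the form of a decomposition by the first step: up to height
  \<open>h + 2\<close> with one up-step used, or down to height \<open>h\<close>.\<close>

lemma ballot_Suc: "ballot (Suc h) (Suc j) = ballot (Suc (Suc h)) j + ballot h (Suc j)"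
  by (cases j) (auto simp: ballot_def)

lemma ballot_1: "ballot 1 n = catalan n"
proof (cases n)
  case (Suc i)
  have "(i + 2) * (2 * i + 2 choose (i + 2)) = (i + 1) * ((2 * i + 2) choose (i + 1))"
  proof -
    have "Suc (Suc i) * (2 * i + 2 choose Suc (Suc i)) = (2 * i + 2 - Suc i) * (2 * i + 2 choose Suc i)"
      by (simp only: binomial_absorption binomial_absorb_comp)
    then show ?thesis by (simp del: binomial_Suc_Suc)
  qed
  moreover have "(2 * i + 2) choose (i + 2) = (2 * i + 2) choose i"
    using binomial_symmetric[of i "2*i+2"] by simp
  ultimately have *: "(i + 2) * ((2 * i + 2) choose i) = (i + 1) * ((2 * i + 2) choose (i + 1))" by simp
  have "real (i + 2) * real ((2 * i + 2) choose i) = real (i + 1) * real ((2 * i + 2) choose (i + 1))"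
    using arg_cong[OF *, of real] by (simp only: of_nat_mult)
  then show ?thesis using Suc
    by (simp add: ballot_def catalan_def field_simps)
qed (simp add: ballot_def catalan_def)

text \<open>Removing the smallest point turns the count into the recursion
  \<open>ballot_Suc\<close>. Starting from height 0 would be different: an excursion may leave 0
  again, whereas \<open>ballot 0 j\<close> vanishes for positive \<open>j\<close>.\<close>

lemma card_passage:
  assumes "finite A" "card A = h + 2 * j" "h \<ge> 1"
  shows "int (card {w \<in> A \<rightarrow>\<^sub>E UNIV. passage (int h) w A}) = ballot h j"
  using assms
proof (induction A arbitrary: h j rule: finite_linorder_min_induct)
  case empty
  then show ?case by simp
next
  case (insert b A)
  have b: "b \<notin> A" using insert.hyps(2) by auto
  have cardA: "card A + 1 = h + 2 * j" using insert.prems insert.hyps(1) b by simp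
  have upd: "passage i (w(b := c)) A \<longleftrightarrow> passage i w A" for i w c
    using b by (intro passage_cong) auto
  have ins: "passage (int h) (w(b := c)) (insert b A) \<longleftrightarrow>
      (A = {} \<or> 0 < int h + step c) \<and> passage (int h + step c) w A" for c w
    using passage_insert[OF insert.hyps(1), of b "int h" "w(b := c)"] insert.hyps(2)
    by (simp add: upd)
  have fin: "finite {w \<in> A \<rightarrow>\<^sub>E (UNIV :: letter set). P w}" for P
    by (rule finite_subset[OF _ finite_PiE[OF insert.hyps(1)]]) auto
  have up: "int (card {w \<in> A \<rightarrow>\<^sub>E UNIV. passage (int h + 1) w A}) = (if j = 0 then 0 else ballot (Suc h) (j - 1))"
  proof (cases j)
    case 0
    \<comment> \<open>Only \<open>h - 1\<close> letters remain, too few to come down from height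
      \<open>h + 1\<close>.\<close>
    have "\<not> passage (int h + 1) w A" for w
    proof
      assume "passage (int h + 1) w A"
      then have "int h + 1 = - (\<Sum>x\<in>A. step (w x))" by (simp add: passage_def)
      also have "\<dots> = (\<Sum>x\<in>A. - step (w x))" by (simp add: sum_negf)
      also have "\<dots> \<le> (\<Sum>x\<in>A. 1)" by (intro sum_mono) (auto simp: step_def split: letter.splits)
      finally show False using cardA 0 by simp
    qed
    then show ?thesis using 0 by simp
  next
    case (Suc i)
    then show ?thesis using insert.IH[of "Suc h" i] cardA by (simp add: add.commute)
  qed
  \<comment> \<open>For \<open>h = 1\<close> the down-step reaches 0 at once, which is allowed only
    when \<open>A\<close> is empty; this is the value of \<open>ballot 0 j\<close>.\<close>
  have down: "int (card {w \<in> A \<rightarrow>\<^sub>E UNIV. (A = {} \<or> 1 < int h) \<and> passage (int h - 1) w A}) = ballot (h - 1) j"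
  proof (cases "h = 1")
    case True
    show ?thesis
    proof (cases "A = {}")
      case True
      then show ?thesis using cardA \<open>h = 1\<close> by (simp add: ballot_0)
    next
      case False
      then have "j \<noteq> 0" using cardA insert.hyps(1) \<open>h = 1\<close> by auto
      then show ?thesis using False \<open>h = 1\<close> by (simp add: ballot_0)
    qed
  next
    case False
    then have "card A = (h - 1) + 2 * j" "h - 1 \<ge> 1" using cardA insert.prems by auto
    from insert.IH[OF this] False insert.prems show ?thesis by (simp add: of_nat_diff)
  qed
  have "int (card {w \<in> insert b A \<rightarrow>\<^sub>E UNIV. passage (int h) w (insert b A)}) =
     (if j = 0 then 0 else ballot (Suc h) (j - 1)) + ballot (h - 1) j"
    unfolding card_words_insert[OF insert.hyps(1) b] ins
    using up down insert.prems by (simp add: UNIV_letter)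
  also have "\<dots> = ballot h j"
    using insert.prems ballot_Suc[of "h - 1" "j - 1"] by (cases j) (auto simp: ballot_j0)
  finally show ?case .
qed

text \<open>The first letter must be \<open>L\<close>; the other \<open>2 * n + 1\<close> letters
  form a first passage from height 1, counted by \<open>ballot 1 n\<close>.\<close>

lemma card_excursion:
  fixes A :: "'a::linorder set"
  assumes "finite A" "card A = 2 * n + 2"
  shows "real (card {w \<in> A \<rightarrow>\<^sub>E UNIV. excursion w A}) = catalan n"
proof -
  define b where "b = Min A"
  define B where "B = A - {b}"
  have "A \<noteq> {}" using assms by auto
  then have "b \<in> A" unfolding b_def using assms by simp
  then have A: "A = insert b B" and bB: "b \<notin> B" and B: "finite B" "card B = 1 + 2 * n"
    using assms by (auto simp: B_def)
  have lt: "b < a" if "a \<in> B" for a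
    using that assms unfolding B_def b_def by (metis Diff_iff Min_le insertI1 order_le_imp_less_or_eq)
  have "B \<noteq> {}" using B by auto
  have upd: "passage i (w(b := c)) B \<longleftrightarrow> passage i w B" for i w c
    using bB by (intro passage_cong) auto
  have ins: "excursion (w(b := c)) (insert b B) \<longleftrightarrow> c = L \<and> passage 1 w B" for c w
    using passage_insert[OF B(1), of b 0 "w(b := c)"] lt \<open>B \<noteq> {}\<close>
    by (cases c) (simp_all add: upd excursion_def)
  have "card {w \<in> A \<rightarrow>\<^sub>E UNIV. excursion w A} = card {w \<in> B \<rightarrow>\<^sub>E UNIV. passage (int 1) w B}"
    unfolding A card_words_insert[OF B(1) bB] ins by (simp add: UNIV_letter)
  then have "int (card {w \<in> A \<rightarrow>\<^sub>E UNIV. excursion w A}) = ballot 1 n"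
    using card_passage[OF B] by simp
  then show ?thesis unfolding ballot_1[symmetric] by (metis of_int_of_nat_eq)
qed

section \<open>Faces of a drawing\<close>

definition arcs :: "'a::linorder set set \<Rightarrow> ('a \<times> 'a) set" where
  "arcs P = {(a, b). a < b \<and> {a, b} \<in> P}"

definition laminar :: "('a::linorder \<times> 'a) set \<Rightarrow> bool" where
  "laminar A \<longleftrightarrow> (\<forall>(a, b)\<in>A. a < b) \<and>
     (\<forall>(a, b)\<in>A. \<forall>(c, d)\<in>A. (a, b) = (c, d) \<or> b < c \<or> d < a \<or> (a < c \<and> d < b) \<or> (c < a \<and> b < d))"

text \<open>Combinatorial counterpart of \<open>face_indices\<close>, with the face replaced by its
  arc.\<close>

definition visible :: "(nat \<times> nat) set \<Rightarrow> nat \<times> nat \<Rightarrow> nat set" where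
  "visible A = (\<lambda>(a, b). {i. a \<le> i \<and> i < b \<and> (\<forall>(c, d)\<in>A. a < c \<and> d < b \<longrightarrow> \<not> (c \<le> i \<and> i < d))})"

text \<open>The power of the point \<open>z\<close> with respect to the circle with diameter \<open>[a; b]\<close>.\<close>

definition pow_pt :: "nat \<Rightarrow> nat \<Rightarrow> complex \<Rightarrow> real" where
  "pow_pt a b z = (Re z)\<^sup>2 + (Im z)\<^sup>2 - (real a + real b) * Re z + real a * real b"

text \<open>The sign \<open>s\<close> is 1 for the upper and -1 for the lower half-plane, so that
  both matchings are treated at once. The arc bounds the face from outside, the arcs nested in it
  from inside.\<close>

definition arc_face :: "real \<Rightarrow> (nat \<times> nat) set \<Rightarrow> nat \<times> nat \<Rightarrow> complex set" where
  "arc_face s A = (\<lambda>(a, b). {z. 0 < s * Im z \<and> pow_pt a b z < 0 \<and>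
     (\<forall>(c, d)\<in>A. a < c \<and> d < b \<longrightarrow> 0 < pow_pt c d z)})"

definition outer_face :: "real \<Rightarrow> (nat \<times> nat) set \<Rightarrow> complex set" where
  "outer_face s A = {z. 0 < s * Im z \<and> (\<forall>(c, d)\<in>A. 0 < pow_pt c d z)}"

lemma pow_pt_altdef: "pow_pt a b z = (Re z - real a) * (Re z - real b) + (Im z)\<^sup>2"
  by (simp add: pow_pt_def algebra_simps power2_eq_square)

lemma pow_pt_cmod: "pow_pt a b z = (cmod (z - (of_nat a + of_nat b) / 2))\<^sup>2 - (\<bar>real b - real a\<bar> / 2)\<^sup>2"
proof -
  have "Re (z - (of_nat a + of_nat b) / 2) = Re z - (real a + real b) / 2"
    "Im (z - (of_nat a + of_nat b) / 2) = Im z" by simp_all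
  then have "(cmod (z - (of_nat a + of_nat b) / 2))\<^sup>2 = (Re z - (real a + real b) / 2)\<^sup>2 + (Im z)\<^sup>2"
    by (simp only: cmod_power2)
  moreover have "(\<bar>real b - real a\<bar> / 2)\<^sup>2 = (real b - real a)\<^sup>2 / 4" by (simp add: power_divide)
  ultimately show ?thesis by (simp add: pow_pt_def field_simps power2_eq_square)
qed

lemma pow_pt_eq_0_iff:
  "pow_pt a b z = 0 \<longleftrightarrow> cmod (z - (of_nat a + of_nat b) / 2) = \<bar>real b - real a\<bar> / 2"
proof -
  have "pow_pt a b z = 0 \<longleftrightarrow> (cmod (z - (of_nat a + of_nat b) / 2))\<^sup>2 = (\<bar>real b - real a\<bar> / 2)\<^sup>2"
    by (simp add: pow_pt_cmod)
  also have "\<dots> \<longleftrightarrow> cmod (z - (of_nat a + of_nat b) / 2) = \<bar>real b - real a\<bar> / 2"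
    by (intro power2_eq_iff_nonneg) auto
  finally show ?thesis .
qed

lemma pow_pt_neg_imp_Re:
  assumes "pow_pt a b z < 0" "a < b"
  shows "real a < Re z" "Re z < real b"
proof -
  have "(Re z - real a) * (Re z - real b) < 0"
    using assms(1) zero_le_power2[of "Im z"] unfolding pow_pt_altdef by linarith
  then show "real a < Re z" "Re z < real b"
    using assms(2) by (auto simp: mult_less_0_iff)
qed

lemma continuous_on_pow_pt [continuous_intros]: "continuous_on S (pow_pt a b)"
  unfolding pow_pt_def by (intro continuous_intros)

lemma convex_above_parabola: "convex {p::real \<times> real. (fst p)\<^sup>2 < snd p}"
proof (rule convexI)
  fix p q :: "real \<times> real" and u v :: real
  assume "p \<in> {p. (fst p)\<^sup>2 < snd p}" "q \<in> {p. (fst p)\<^sup>2 < snd p}" and uv: "0 \<le> u" "0 \<le> v" "u + v = 1"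
  then have p: "(fst p)\<^sup>2 < snd p" and q: "(fst q)\<^sup>2 < snd q" by auto
  have v: "v = 1 - u" using uv by simp
  have "u * (fst p)\<^sup>2 + v * (fst q)\<^sup>2 - (u * fst p + v * fst q)\<^sup>2 = u * v * (fst p - fst q)\<^sup>2"
    unfolding v by (simp add: algebra_simps power2_eq_square)
  then have "(u * fst p + v * fst q)\<^sup>2 \<le> u * (fst p)\<^sup>2 + v * (fst q)\<^sup>2"
    using uv by (smt (verit) mult_nonneg_nonneg zero_le_power2)
  also have "\<dots> < u * snd p + v * snd q"
  proof (cases "u = 0")
    case True
    then show ?thesis using q uv by simp
  next
    case False
    then have "u * (fst p)\<^sup>2 < u * snd p" using p uv by simp
    moreover have "v * (fst q)\<^sup>2 \<le> v * snd q" using q uv by (simp add: mult_left_mono)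
    ultimately show ?thesis by simp
  qed
  finally show "u *\<^sub>R p + v *\<^sub>R q \<in> {p. (fst p)\<^sup>2 < snd p}" by simp
qed

text \<open>The map \<open>z \<mapsto> (Re z, \<bar>z\<bar>\<^sup>2)\<close> straightens all circles centred on the real axis at once (it sends a
  half-plane to the interior of a parabola), so that the faces become convex.\<close>

lemma connected_half_plane_region:
  assumes s: "s \<in> {1, -1 :: real}"
  shows "connected {z. 0 < s * Im z \<and> (\<forall>(a, b)\<in>N. pow_pt a b z < 0) \<and> (\<forall>(a, b)\<in>A. 0 < pow_pt a b z)}"
    (is "connected ?S")
proof -
  \<comment> \<open>\<open>pow_pt a b z\<close> depends on \<open>z\<close> only through the real
    part and the squared modulus, and affinely on these: each circle becomes a line.\<close>
  define lin where "lin a b p = snd p - (real a + real b) * fst p + real a * real b" for a b :: nat and p :: "real \<times> real"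
  define T where "T = {p::real \<times> real. (fst p)\<^sup>2 < snd p} \<inter> (\<Inter>(a, b)\<in>N. {p. lin a b p < 0}) \<inter> (\<Inter>(a, b)\<in>A. {p. 0 < lin a b p})"
  have 1: "convex {p. lin a b p < 0}" for a b
  proof -
    have "{p. lin a b p < 0} = {p. (- (real a + real b), 1) \<bullet> p < - (real a * real b)}"
      by (auto simp: lin_def inner_prod_def algebra_simps)
    then show ?thesis by (simp only: convex_halfspace_lt)
  qed
  have 2: "convex {p. 0 < lin a b p}" for a b
  proof -
    have "{p. 0 < lin a b p} = {p. (- (real a + real b), 1) \<bullet> p > - (real a * real b)}"
      by (auto simp: lin_def inner_prod_def algebra_simps)
    then show ?thesis by (simp only: convex_halfspace_gt)
  qed
  have "convex T" unfolding T_def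
    by (intro convex_Int convex_above_parabola convex_INT) (auto intro: 1 2)
  \<comment> \<open>Inverse of the straightening map; the sign \<open>s\<close> selects the
    half-plane.\<close>
  define f where "f p = Complex (fst p) (s * sqrt (snd p - (fst p)\<^sup>2))" for p :: "real \<times> real"
  have "continuous_on T f" unfolding f_def by (intro continuous_intros)
  then have "connected (f ` T)"
    using \<open>convex T\<close> connected_continuous_image convex_connected by blast
  moreover have "f ` T = ?S"
  proof
    have pf: "pow_pt a b (f p) = lin a b p" if "p \<in> T" for a b p
      using that s by (auto simp: pow_pt_def lin_def f_def T_def power_mult_distrib)
    have "0 < s * Im (f p)" if "p \<in> T" for p using that s by (auto simp: f_def T_def)
    with pf show "f ` T \<subseteq> ?S" by (auto simp: T_def split: prod.splits)
    show "?S \<subseteq> f ` T"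
    proof
      fix z assume z: "z \<in> ?S"
      define p where "p = (Re z, (Re z)\<^sup>2 + (Im z)\<^sup>2)"
      have lp: "lin a b p = pow_pt a b z" for a b by (simp add: lin_def p_def pow_pt_def)
      have "Im z \<noteq> 0" using z by auto
      then have "p \<in> T" using z lp by (auto simp: T_def p_def split: prod.splits)
      moreover have "f p = z" using z s by (auto simp: f_def p_def complex_eq_iff abs_if mult_less_0_iff)
      ultimately show "z \<in> f ` T" by blast
    qed
  qed
  ultimately show ?thesis by simp
qed

lemma connected_arc_face:
  assumes "s \<in> {1, -1 :: real}"
  shows "connected (arc_face s A p)"
proof -
  obtain a b where p: "p = (a, b)" by fastforce
  have "arc_face s A p = {z. 0 < s * Im z \<and> (\<forall>(a, b)\<in>{(a, b)}. pow_pt a b z < 0) \<and>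
      (\<forall>(c, d)\<in>{(c, d)\<in>A. a < c \<and> d < b}. 0 < pow_pt c d z)}"
    by (auto simp: arc_face_def p)
  then show ?thesis by (simp only: connected_half_plane_region[OF assms])
qed

lemma connected_outer_face:
  assumes "s \<in> {1, -1 :: real}"
  shows "connected (outer_face s A)"
  using connected_half_plane_region[OF assms, of "{}" A] by (simp add: outer_face_def)

lemma open_pow_pt_region:
  assumes "finite A"
  shows "open {z. 0 < s * Im z \<and> (\<forall>(c, d)\<in>A. Q c d \<longrightarrow> 0 < pow_pt c d z)}"
proof -
  have "{z. 0 < s * Im z \<and> (\<forall>(c, d)\<in>A. Q c d \<longrightarrow> 0 < pow_pt c d z)} =
     {z. 0 < s * Im z} \<inter> (\<Inter>(c, d)\<in>{(c, d)\<in>A. Q c d}. {z. 0 < pow_pt c d z})" by auto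
  moreover have "finite {(c, d)\<in>A. Q c d}" using assms by (rule rev_finite_subset) auto
  ultimately show ?thesis
    by (auto intro!: open_Int open_INT open_Collect_less continuous_intros)
qed

lemma open_outer_face: "finite A \<Longrightarrow> open (outer_face s A)"
  using open_pow_pt_region[of A s "\<lambda>_ _. True"] by (simp add: outer_face_def)

lemma open_arc_face:
  assumes "finite A"
  shows "open (arc_face s A p)"
proof -
  obtain a b where p: "p = (a, b)" by fastforce
  have "arc_face s A p = {z. pow_pt a b z < 0} \<inter>
      {z. 0 < s * Im z \<and> (\<forall>(c, d)\<in>A. (a < c \<and> d < b) \<longrightarrow> 0 < pow_pt c d z)}"
    by (auto simp: arc_face_def p)
  then show ?thesis
    by (auto intro!: open_Int open_pow_pt_region[OF assms] open_Collect_less continuous_intros)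
qed

lemma bounded_arc_face: "bounded (arc_face s A p)"
proof -
  obtain a b where p: "p = (a, b)" by fastforce
  have "arc_face s A p \<subseteq> cball ((of_nat a + of_nat b) / 2) (\<bar>real b - real a\<bar> / 2)"
  proof
    fix z assume "z \<in> arc_face s A p"
    then have "pow_pt a b z < 0" by (simp add: arc_face_def p)
    then have "(cmod (z - (of_nat a + of_nat b) / 2))\<^sup>2 \<le> (\<bar>real b - real a\<bar> / 2)\<^sup>2"
      unfolding pow_pt_cmod by linarith
    then have "cmod (z - (of_nat a + of_nat b) / 2) \<le> \<bar>real b - real a\<bar> / 2"
      by (rule power2_le_imp_le) simp
    then show "z \<in> cball ((of_nat a + of_nat b) / 2) (\<bar>real b - real a\<bar> / 2)"
      by (simp add: dist_norm norm_minus_commute)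
  qed
  then show ?thesis using bounded_cball bounded_subset by blast
qed

lemma not_bounded_outer_face:
  assumes "s \<in> {1, -1 :: real}"
  shows "\<not> bounded (outer_face s A)"
proof
  assume "bounded (outer_face s A)"
  then obtain B where B: "\<And>z. z \<in> outer_face s A \<Longrightarrow> cmod z \<le> B" unfolding bounded_iff by blast
  define t where "t = \<bar>B\<bar> + 1"
  have t: "t > 0" by (simp add: t_def)
  \<comment> \<open>On the imaginary axis the power is \<open>t^2 + a * b\<close>, positive for
    every circle.\<close>
  have "Complex 0 (s * t) \<in> outer_face s A"
    using assms t by (auto simp: outer_face_def pow_pt_def intro!: add_pos_nonneg)
  then have "cmod (Complex 0 (s * t)) \<le> B" by (rule B)
  moreover have "cmod (Complex 0 (s * t)) = t" using assms t by (auto simp: complex_norm)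
  ultimately show False by (simp add: t_def)
qed

text \<open>The bound on \<open>t\<close> says that the point is inside the circle of the arc. It is
  outside the nested circles because no nested arc covers the gap, so that \<open>x\<close> is not
  strictly between their ends.\<close>

lemma visible_point_arc_face:
  assumes s: "s \<in> {1, -1 :: real}" and lt: "\<And>c d. (c, d) \<in> A \<Longrightarrow> c < d" and i: "i \<in> visible A (a, b)"
    and x: "real i < x" "x < real i + 1" and t: "0 < t" "t\<^sup>2 < (x - real a) * (real b - x)"
  shows "Complex x (s * t) \<in> arc_face s A (a, b)"
proof -
  have s2: "s * s = 1" using s by auto
  have "0 < pow_pt c d (Complex x (s * t))" if cd: "(c, d) \<in> A" "a < c" "d < b" for c d
  proof -
    have "\<not> (c \<le> i \<and> i < d)" using i cd by (auto simp: visible_def)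
    then consider "Suc i \<le> c" "Suc i \<le> d" | "c \<le> i" "d \<le> i"
      using lt[OF cd(1)] by linarith
    then have "0 \<le> (x - real c) * (x - real d)"
    proof cases
      case 1
      then have "x \<le> real c" "x \<le> real d" using x by linarith+
      then show ?thesis by (intro mult_nonpos_nonpos) auto
    next
      case 2
      then have "real c \<le> x" "real d \<le> x" using x by linarith+
      then show ?thesis by (intro mult_nonneg_nonneg) auto
    qed
    moreover have "0 < (s * t)\<^sup>2" using t s by auto
    ultimately show ?thesis by (simp add: pow_pt_altdef add_nonneg_pos)
  qed
  moreover have "pow_pt a b (Complex x (s * t)) < 0"
    using t(2) s2 s by (auto simp: pow_pt_altdef algebra_simps)
  moreover have "0 < s * (s * t)" using s t by auto
  ultimately show ?thesis by (auto simp: arc_face_def)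
qed

text \<open>Interior points of the gap are approached vertically from inside the face; its two ends
  follow by taking closures.\<close>

lemma closed_segment_subset_closure_arc_face:
  assumes s: "s \<in> {1, -1 :: real}" and lt: "\<And>c d. (c, d) \<in> A \<Longrightarrow> c < d" and i: "i \<in> visible A (a, b)"
  shows "closed_segment (of_nat i) (of_nat (i + 1)) \<subseteq> closure (arc_face s A (a, b))"
proof -
  have ab: "a \<le> i" "i < b" using i by (auto simp: visible_def)
  have "open_segment (of_nat i) (of_nat (i + 1)) \<subseteq> closure (arc_face s A (a, b))"
  proof
    fix z :: complex assume "z \<in> open_segment (of_nat i) (of_nat (i + 1))"
    then obtain u where u: "0 < u" "u < 1" and z: "z = (1 - u) *\<^sub>R of_nat i + u *\<^sub>R of_nat (i + 1)"
      unfolding in_segment by blast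
    define x where "x = real i + u"
    have zx: "z = Complex x 0" by (simp add: z x_def complex_eq_iff algebra_simps)
    have x: "real i < x" "x < real i + 1" using u by (auto simp: x_def)
    define K where "K = (x - real a) * (real b - x)"
    have "real i \<ge> real a" "real i + 1 \<le> real b" using ab by linarith+
    then have K: "K > 0" using x unfolding K_def by (intro mult_pos_pos) linarith+
    show "z \<in> closure (arc_face s A (a, b))"
    proof (unfold closure_approachable, intro allI impI)
      fix e :: real assume e: "e > 0"
      \<comment> \<open>The cap 1 gives \<open>t^2 \<le> t\<close>, so \<open>t < K\<close> suffices
        to stay inside the circle.\<close>
      define t where "t = min (e / 2) (min 1 (K / 2))"
      have t: "0 < t" "t < e" "t \<le> 1" "t < K" using e K by (auto simp: t_def)
      have "t\<^sup>2 \<le> t * 1" using t by (simp add: power2_eq_square mult_left_mono)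
      then have "t\<^sup>2 < K" using t by simp
      then have "Complex x (s * t) \<in> arc_face s A (a, b)"
        using visible_point_arc_face[OF s lt i x t(1)] by (simp add: K_def)
      moreover have "dist (Complex x (s * t)) z < e"
        using t s by (auto simp: zx dist_norm complex_diff complex_norm)
      ultimately show "\<exists>y\<in>arc_face s A (a, b). dist y z < e" by blast
    qed
  qed
  then have "closure (open_segment (of_nat i) (of_nat (i + 1))) \<subseteq> closure (arc_face s A (a, b))"
    by (rule closure_minimal) simp
  moreover have "(of_nat i :: complex) \<noteq> of_nat (i + 1)" by simp
  then have "closure (open_segment (of_nat i) (of_nat (i + 1))) = closed_segment (of_nat i) (of_nat (i + 1) :: complex)"
    by (simp only: closure_open_segment if_False)
  ultimately show ?thesis by simp
qed

lemma closure_arc_face_subset: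
  "closure (arc_face s A (a, b)) \<subseteq>
     {z. pow_pt a b z \<le> 0 \<and> (\<forall>(c, d)\<in>A. a < c \<and> d < b \<longrightarrow> 0 \<le> pow_pt c d z)}" (is "_ \<subseteq> ?S")
proof (rule closure_minimal)
  show "arc_face s A (a, b) \<subseteq> ?S" by (auto simp: arc_face_def intro: less_imp_le)
  have "?S = {z. pow_pt a b z \<le> 0} \<inter> (\<Inter>(c, d)\<in>{(c, d)\<in>A. a < c \<and> d < b}. {z. 0 \<le> pow_pt c d z})"
    by auto
  then show "closed ?S"
    by (auto intro!: closed_Int closed_INT closed_Collect_le continuous_intros)
qed

text \<open>For the direction from frontier to \<open>visible\<close> the midpoint of the gap is
  enough: a half-integer is never an end of an arc, so the weak inequalities that hold on the
  closure are automatically strict there and locate the gap.\<close>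

lemma segment_subset_frontier_arc_face_iff:
  assumes s: "s \<in> {1, -1 :: real}" and lt: "\<And>c d. (c, d) \<in> A \<Longrightarrow> c < d" and fin: "finite A" and ab: "(a, b) \<in> A"
  shows "closed_segment (of_nat i) (of_nat (i + 1)) \<subseteq> frontier (arc_face s A (a, b)) \<longleftrightarrow> i \<in> visible A (a, b)"
proof
  assume i: "i \<in> visible A (a, b)"
  have "Im z = 0" if "z \<in> closed_segment (of_nat i) (of_nat (i + 1))" for z :: complex
    using that by (auto simp: in_segment)
  then have "closed_segment (of_nat i) (of_nat (i + 1)) \<inter> arc_face s A (a, b) = {}"
    by (fastforce simp: arc_face_def)
  then show "closed_segment (of_nat i) (of_nat (i + 1)) \<subseteq> frontier (arc_face s A (a, b))"
    using closed_segment_subset_closure_arc_face[OF s lt i] interior_subset by (fastforce simp: frontier_def)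
next
  assume "closed_segment (of_nat i) (of_nat (i + 1)) \<subseteq> frontier (arc_face s A (a, b))"
  moreover have "midpoint (of_nat i) (of_nat (i + 1)) \<in> closed_segment (of_nat i) (of_nat (i + 1) :: complex)"
    by (rule midpoint_in_closed_segment)
  moreover have "midpoint (of_nat i) (of_nat (i + 1)) = Complex (real i + 1/2) 0"
    by (simp add: midpoint_def complex_eq_iff)
  ultimately have "Complex (real i + 1/2) 0 \<in> closure (arc_face s A (a, b))"
    unfolding frontier_def by (metis Diff_iff subsetD)
  from subsetD[OF closure_arc_face_subset this]
  have le: "(real i + 1/2 - real a) * (real i + 1/2 - real b) \<le> 0"
    and ge: "\<And>c d. (c, d) \<in> A \<Longrightarrow> a < c \<Longrightarrow> d < b \<Longrightarrow> 0 \<le> (real i + 1/2 - real c) * (real i + 1/2 - real d)"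
    by (auto simp: pow_pt_altdef)
  have *: "(real i + 1/2 - real c) * (real i + 1/2 - real d) < 0" if "c \<le> i" "i < d" for c d
    using that by (intro mult_pos_neg) linarith+
  have "a \<le> i \<and> i < b"
  proof (rule ccontr)
    assume "\<not> (a \<le> i \<and> i < b)"
    then consider "i < a" "i < b" | "a \<le> i" "b \<le> i" using lt[OF ab] by linarith
    then have "0 < (real i + 1/2 - real a) * (real i + 1/2 - real b)"
    proof cases
      case 1 then show ?thesis by (intro mult_neg_neg) linarith+
    next
      case 2 then show ?thesis by (intro mult_pos_pos) linarith+
    qed
    then show False using le by linarith
  qed
  moreover have "\<not> (c \<le> i \<and> i < d)" if "(c, d) \<in> A" "a < c" "d < b" for c d
    using ge[OF that] *[of c d] by linarith
  ultimately show "i \<in> visible A (a, b)" by (auto simp: visible_def)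
qed

lemma arc_face_nonempty:
  assumes "s \<in> {1, -1 :: real}" "\<And>c d. (c, d) \<in> A \<Longrightarrow> c < d" "(a, b) \<in> A"
  shows "arc_face s A (a, b) \<noteq> {}"
proof -
  have "a \<in> visible A (a, b)" using assms by (auto simp: visible_def)
  from closed_segment_subset_closure_arc_face[OF assms(1,2) this] show ?thesis by auto
qed

lemma laminarD: "laminar A \<Longrightarrow> (a, b) \<in> A \<Longrightarrow> a < b"
  by (auto simp: laminar_def)

lemma laminar_cases:
  assumes "laminar A" "(a, b) \<in> A" "(c, d) \<in> A"
  shows "(a, b) = (c, d) \<or> b < c \<or> d < a \<or> (a < c \<and> d < b) \<or> (c < a \<and> b < d)"
  using assms unfolding laminar_def by blast

text \<open>A common point lies in both discs, hence above both intervals; by laminarity the arcs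
  are nested, and then the face of the outer arc excludes the disc of the inner one.\<close>

lemma arc_face_disjoint:
  assumes "laminar A" "p \<in> A" "q \<in> A" "p \<noteq> q"
  shows "arc_face s A p \<inter> arc_face s A q = {}"
proof (rule ccontr)
  obtain a b c d where pq: "p = (a, b)" "q = (c, d)" by (metis surj_pair)
  assume "arc_face s A p \<inter> arc_face s A q \<noteq> {}"
  then obtain z where z: "z \<in> arc_face s A (a, b)" "z \<in> arc_face s A (c, d)" using pq by auto
  then have neg: "pow_pt a b z < 0" "pow_pt c d z < 0" by (auto simp: arc_face_def)
  have "real a < Re z" "Re z < real b" "real c < Re z" "Re z < real d"
    using pow_pt_neg_imp_Re neg laminarD[OF assms(1)] assms(2,3) pq by blast+
  then have "\<not> b < c" "\<not> d < a" by linarith+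
  then have "(a < c \<and> d < b) \<or> (c < a \<and> b < d)"
    using laminar_cases[OF assms(1)] assms(2-4) pq by blast
  then show False using z neg assms(2,3) pq by (auto simp: arc_face_def)
qed

lemma arc_face_outer_disjoint: "p \<in> A \<Longrightarrow> arc_face s A p \<inter> outer_face s A = {}"
  by (fastforce simp: arc_face_def outer_face_def)

text \<open>A point off the circles lies in the face of the shortest arc whose disc contains it, or
  outside all discs.\<close>

lemma half_plane_cover:
  assumes "laminar A" "finite A"
  shows "{z. 0 < s * Im z \<and> (\<forall>(a, b)\<in>A. pow_pt a b z \<noteq> 0)} = outer_face s A \<union> (\<Union>p\<in>A. arc_face s A p)"
    (is "?S = ?T")
proof
  show "?S \<subseteq> ?T"
  proof
    fix z assume z: "z \<in> ?S"
    show "z \<in> ?T"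
    proof (cases "\<exists>p\<in>A. pow_pt (fst p) (snd p) z < 0")
      case False
      then show ?thesis using z by (force simp: outer_face_def)
    next
      case True
      define B where "B = {p\<in>A. pow_pt (fst p) (snd p) z < 0}"
      have "\<exists>p. p \<in> B" using True unfolding B_def by blast
      then obtain p where p: "p \<in> B" "\<And>q. q \<in> B \<Longrightarrow> snd p - fst p \<le> snd q - fst q"
        using ex_has_least_nat[of "\<lambda>p. p \<in> B" _ "\<lambda>p. snd p - fst p"] by blast
      obtain a b where ab: "p = (a, b)" by fastforce
      have "0 < pow_pt c d z" if cd: "(c, d) \<in> A" "a < c" "d < b" for c d
      proof (rule ccontr)
        assume "\<not> 0 < pow_pt c d z"
        then have "(c, d) \<in> B" using z cd by (force simp: B_def)
        from p(2)[OF this] show False using cd laminarD[OF assms(1) cd(1)] ab by simp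
      qed
      moreover have "p \<in> A" "pow_pt a b z < 0" using p(1) by (auto simp: ab B_def)
      ultimately have "z \<in> arc_face s A p" using z by (auto simp: arc_face_def ab)
      then show ?thesis using \<open>p \<in> A\<close> by blast
    qed
  qed
  have "pow_pt c d z \<noteq> 0" if z: "z \<in> arc_face s A (a, b)" and ab: "(a, b) \<in> A" and cd: "(c, d) \<in> A" for a b c d z
  proof
    assume 0: "pow_pt c d z = 0"
    have neg: "pow_pt a b z < 0" and pos: "0 < s * Im z" using z by (auto simp: arc_face_def)
    have Re: "real a < Re z" "Re z < real b" using pow_pt_neg_imp_Re[OF neg laminarD[OF assms(1) ab]] .
    have "(Re z - real c) * (Re z - real d) < 0"
    proof -
      have "0 < (Im z)\<^sup>2" using pos by auto
      then show ?thesis using 0 unfolding pow_pt_altdef by linarith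
    qed
    then have Re': "real c < Re z" "Re z < real d" using laminarD[OF assms(1) cd] by (auto simp: mult_less_0_iff)
    have "\<not> b < c" "\<not> d < a" using Re Re' by linarith+
    moreover have "(a, b) \<noteq> (c, d)" using 0 neg by auto
    moreover have "\<not> (a < c \<and> d < b)" using z 0 cd by (auto simp: arc_face_def)
    ultimately have nest: "c < a" "b < d" using laminar_cases[OF assms(1) ab cd] by auto
    \<comment> \<open>Inside the smaller of two nested discs the power with respect to the larger
      circle is smaller still, hence cannot vanish.\<close>
    have "pow_pt c d z - pow_pt a b z = (real a - real c) * (Re z - real b) + (real b - real d) * (Re z - real c)"
      by (simp add: pow_pt_def algebra_simps)
    moreover have "(real a - real c) * (Re z - real b) < 0" using nest Re by (intro mult_pos_neg) auto
    moreover have "(real b - real d) * (Re z - real c) < 0" using nest Re' by (intro mult_neg_pos) auto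
    ultimately show False using 0 neg by linarith
  qed
  then show "?T \<subseteq> ?S" by (fastforce simp: outer_face_def arc_face_def)
qed


text \<open>The factor of one face in the formula; it is four times the probability of an excursion
  on \<open>2 * n + 2\<close> given points.\<close>

definition arc_weight :: "nat \<Rightarrow> real" where
  "arc_weight n = catalan n * 2 powi (- 2 * int n)"

text \<open>In a partition into open sets the union of the other pieces is open too, so a connected
  set cannot straddle two pieces.\<close>

lemma components_eqI:
  fixes S :: "'a::topological_space set"
  assumes U: "\<Union>F = S" and F: "\<And>X. X \<in> F \<Longrightarrow> open X \<and> connected X \<and> X \<noteq> {}"
    and disj: "\<And>X Y. X \<in> F \<Longrightarrow> Y \<in> F \<Longrightarrow> X \<noteq> Y \<Longrightarrow> X \<inter> Y = {}"
  shows "components S = F"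
proof -
  have sub: "X \<in> components S" if X: "X \<in> F" for X
    unfolding in_components_maximal
  proof (intro conjI allI impI)
    show "X \<noteq> {}" "X \<subseteq> S" "connected X" using X F U by auto
    fix D assume D: "D \<noteq> {} \<and> X \<subseteq> D \<and> D \<subseteq> S \<and> connected D"
    have "open (\<Union>(F - {X}))" using F by (intro open_Union) auto
    moreover have "X \<inter> \<Union>(F - {X}) \<inter> D = {}" using disj[OF X] by blast
    moreover have "D \<subseteq> X \<union> \<Union>(F - {X})" using D U by blast
    ultimately have "X \<inter> D = {} \<or> \<Union>(F - {X}) \<inter> D = {}"
      using connectedD[of D X "\<Union>(F - {X})"] D F[OF X] by blast
    moreover have "X \<inter> D \<noteq> {}" using D F[OF X] by blast
    ultimately show "D = X" using D U by blast
  qed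
  moreover have "Y \<in> F" if Y: "Y \<in> components S" for Y
  proof -
    obtain y where "y \<in> Y" using in_components_nonempty[OF Y] by blast
    then obtain X where X: "X \<in> F" "y \<in> X" using in_components_subset[OF Y] U by blast
    then have "Y = X" using components_nonoverlap[OF Y sub[OF X(1)]] \<open>y \<in> Y\<close> by blast
    then show ?thesis using X by simp
  qed
  ultimately show ?thesis by blast
qed

section \<open>Arcs of a noncrossing matching\<close>

lemma noncrossing_matching_partner_unique:
  assumes "noncrossing_matching A P" "{a, b} \<in> P" "{a, c} \<in> P"
  shows "b = c"
proof -
  have "disjoint P"
    using assms(1) by (simp add: noncrossing_matching_def partition_on_def)
  then have "{a, b} = {a, c}" using disjointD[OF _ assms(2,3)] by blast
  then show ?thesis by (auto simp: doubleton_eq_iff)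
qed

lemma noncrossing_matching_partner_exists:
  assumes "noncrossing_matching A P" "a \<in> A"
  shows "\<exists>b\<in>A. b \<noteq> a \<and> {a, b} \<in> P"
proof -
  obtain p where p: "p \<in> P" "a \<in> p" "card p = 2" "p \<subseteq> A"
    using assms unfolding noncrossing_matching_def partition_on_def by blast
  then obtain x y where "p = {x, y}" "x \<noteq> y" by (auto simp: card_2_iff)
  then show ?thesis using p by (auto simp: insert_commute)
qed

lemma noncrossing_matching_pairD:
  assumes "noncrossing_matching A P" "{a, b} \<in> P"
  shows "a \<in> A" "b \<in> A" "a \<noteq> b"
  using assms unfolding noncrossing_matching_def partition_on_def by (auto simp: card_insert_if)

lemma arcs_subset: "noncrossing_matching A P \<Longrightarrow> arcs P \<subseteq> A \<times> A"
  using noncrossing_matching_pairD by (fastforce simp: arcs_def)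

lemma laminar_arcs:
  assumes "noncrossing_matching A P"
  shows "laminar (arcs P)"
proof -
  have cr: "\<not> (i < j \<and> j < k \<and> k < l \<and> {i, k} \<in> P \<and> {j, l} \<in> P)" for i j k l
    using assms unfolding noncrossing_matching_def by blast
  note u = noncrossing_matching_partner_unique[OF assms]
  have "(a, b) = (c, d) \<or> b < c \<or> d < a \<or> (a < c \<and> d < b) \<or> (c < a \<and> b < d)"
    if "a < b" "{a, b} \<in> P" "c < d" "{c, d} \<in> P" for a b c d
  proof (cases "a = c \<or> b = d \<or> a = d \<or> b = c")
    case True
    have "{b, a} \<in> P" "{d, c} \<in> P" using that by (simp_all add: insert_commute)
    with True that u show ?thesis by (metis less_asym)
  next
    case False
    then show ?thesis using cr[of a c b d] cr[of c a d b] that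
      by (metis linorder_less_linear)
  qed
  then show ?thesis unfolding laminar_def arcs_def by blast
qed

section \<open>Faces of the drawing in terms of arcs\<close>

text \<open>The real axis belongs to the drawing, so the complement splits into the open
  half-planes; within each of them only the arcs of one matching occur, and lying on an arc means
  lying on its circle.\<close>

lemma drawing_complement:
  assumes "noncrossing_matching A (fst C)" "noncrossing_matching B (snd C)"
  shows "- drawing C = {z. 0 < 1 * Im z \<and> (\<forall>(a, b)\<in>arcs (fst C). pow_pt a b z \<noteq> 0)} \<union>
     {z. 0 < -1 * Im z \<and> (\<forall>(a, b)\<in>arcs (snd C). pow_pt a b z \<noteq> 0)}"
proof -
  have comm: "pow_pt a b z = pow_pt b a z" for a b z by (simp add: pow_pt_def algebra_simps)
  have ex: "(\<exists>a b. {a, b} \<in> P \<and> pow_pt a b z = 0) \<longleftrightarrow> (\<exists>(a, b)\<in>arcs P. pow_pt a b z = 0)"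
    if P: "noncrossing_matching A P" for A :: "nat set" and P z
  proof
    assume "\<exists>a b. {a, b} \<in> P \<and> pow_pt a b z = 0"
    then obtain a b where ab: "{a, b} \<in> P" "pow_pt a b z = 0" by blast
    then have "{b, a} \<in> P" "pow_pt b a z = 0" by (simp_all add: insert_commute comm)
    moreover have "a < b \<or> b < a" using noncrossing_matching_pairD(3)[OF P ab(1)] by auto
    ultimately show "\<exists>(a, b)\<in>arcs P. pow_pt a b z = 0" using ab unfolding arcs_def by blast
  qed (auto simp: arcs_def)
  have "z \<in> drawing C \<longleftrightarrow> Im z = 0 \<or> (0 \<le> Im z \<and> (\<exists>a b. {a, b} \<in> fst C \<and> pow_pt a b z = 0)) \<or>
     (Im z \<le> 0 \<and> (\<exists>a b. {a, b} \<in> snd C \<and> pow_pt a b z = 0))" for z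
    unfolding drawing_def upper_arc_def lower_arc_def pow_pt_eq_0_iff complex_is_Real_iff[symmetric] by blast
  then have "z \<in> drawing C \<longleftrightarrow> Im z = 0 \<or> (0 \<le> Im z \<and> (\<exists>(a, b)\<in>arcs (fst C). pow_pt a b z = 0)) \<or>
     (Im z \<le> 0 \<and> (\<exists>(a, b)\<in>arcs (snd C). pow_pt a b z = 0))" for z
    by (simp only: ex[OF assms(1)] ex[OF assms(2)])
  then show ?thesis by fastforce
qed

text \<open>The components are the faces of the arcs together with one outer face in each
  half-plane; boundedness removes exactly the outer ones.\<close>

lemma faces_eq:
  assumes C1: "noncrossing_matching A (fst C)" and C2: "noncrossing_matching A (snd C)" and A: "finite A"
  shows "faces C = arc_face 1 (arcs (fst C)) ` arcs (fst C) \<union> arc_face (-1) (arcs (snd C)) ` arcs (snd C)"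
proof -
  define U V where "U = arcs (fst C)" and "V = arcs (snd C)"
  have lam: "laminar U" "laminar V" using laminar_arcs C1 C2 by (auto simp: U_def V_def)
  have fin: "finite U" "finite V"
    using finite_subset[OF arcs_subset] C1 C2 A unfolding U_def V_def by blast+
  define F where "F = insert (outer_face 1 U) (arc_face 1 U ` U) \<union> insert (outer_face (-1) V) (arc_face (-1) V ` V)"
  have s: "(1::real) \<in> {1, -1}" "(-1::real) \<in> {1, -1}" by auto
  have ne: "X \<noteq> {}" if "s \<in> {1, -1 :: real}" "laminar W" "X \<in> insert (outer_face s W) (arc_face s W ` W)" for s W X
  proof -
    have "outer_face s W \<noteq> {}" using not_bounded_outer_face[OF that(1), of W] by auto
    moreover have "arc_face s W p \<noteq> {}" if "p \<in> W" for p
      using arc_face_nonempty[OF \<open>s \<in> {1, -1}\<close> laminarD[OF \<open>laminar W\<close>], of W "fst p" "snd p"] that by simp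
    ultimately show ?thesis using that(3) by blast
  qed
  have half: "X \<subseteq> {z. 0 < s * Im z}" if "X \<in> insert (outer_face s W) (arc_face s W ` W)" for s W X
    using that by (auto simp: outer_face_def arc_face_def)
  have dis: "X \<inter> Y = {}" if "laminar W" "X \<in> insert (outer_face s W) (arc_face s W ` W)"
    "Y \<in> insert (outer_face s W) (arc_face s W ` W)" "X \<noteq> Y" for s W X Y
    using that(2)
  proof (rule insertE)
    assume X: "X = outer_face s W"
    then have "Y \<in> arc_face s W ` W" using that(3,4) by simp
    then obtain q where "q \<in> W" "Y = arc_face s W q" by blast
    then show ?thesis using arc_face_outer_disjoint[of q W s] X by (simp add: Int_commute)
  next
    assume "X \<in> arc_face s W ` W"
    then obtain p where p: "p \<in> W" "X = arc_face s W p" by blast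
    from that(3) show ?thesis
    proof (rule insertE)
      assume "Y = outer_face s W"
      then show ?thesis using arc_face_outer_disjoint[of p W s] p by simp
    next
      assume "Y \<in> arc_face s W ` W"
      then obtain q where q: "q \<in> W" "Y = arc_face s W q" by blast
      then have "p \<noteq> q" using that(4) p by auto
      then show ?thesis using arc_face_disjoint[OF that(1) p(1) q(1), of s] p q by simp
    qed
  qed
  have "components (- drawing C) = F"
  proof (rule components_eqI)
    show "\<Union>F = - drawing C"
      unfolding drawing_complement[OF C1 C2] F_def
      using half_plane_cover[OF lam(1) fin(1), of 1] half_plane_cover[OF lam(2) fin(2), of "-1"]
      unfolding U_def V_def by auto
    show "open X \<and> connected X \<and> X \<noteq> {}" if "X \<in> F" for X
    proof (intro conjI)
      show "X \<noteq> {}" using that ne[OF s(1) lam(1)] ne[OF s(2) lam(2)] unfolding F_def by blast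
      show "connected X" using that connected_outer_face[OF s(1)] connected_outer_face[OF s(2)]
          connected_arc_face[OF s(1)] connected_arc_face[OF s(2)] unfolding F_def by blast
      show "open X" using that open_outer_face[OF fin(1)] open_outer_face[OF fin(2)]
          open_arc_face[OF fin(1)] open_arc_face[OF fin(2)] unfolding F_def by blast
    qed
    show "X \<inter> Y = {}" if "X \<in> F" "Y \<in> F" "X \<noteq> Y" for X Y
    proof -
      have *: "X \<inter> Y = {}" if "X \<subseteq> {z. 0 < 1 * Im z}" "Y \<subseteq> {z. 0 < -1 * Im z}" for X Y
        using that by fastforce
      show ?thesis
        using that(1) unfolding F_def
      proof (elim UnE)
        assume X: "X \<in> insert (outer_face 1 U) (arc_face 1 U ` U)"
        from that(2) show ?thesis unfolding F_def
          using dis[OF lam(1) X _ that(3)] *[OF half[OF X] half] by (elim UnE)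
      next
        assume X: "X \<in> insert (outer_face (-1) V) (arc_face (-1) V ` V)"
        from that(2) show ?thesis unfolding F_def
          using dis[OF lam(2) X _ that(3)] *[OF half half[OF X], of Y U] by (elim UnE) (simp add: Int_commute, simp)
      qed
    qed
  qed
  moreover have "bounded X \<longleftrightarrow> X \<in> arc_face 1 U ` U \<union> arc_face (-1) V ` V" if "X \<in> F" for X
    using that bounded_arc_face not_bounded_outer_face[OF s(1), of U] not_bounded_outer_face[OF s(2), of V]
    unfolding F_def by blast
  ultimately show ?thesis
    unfolding faces_def U_def[symmetric] V_def[symmetric] by (auto simp: F_def)
qed

lemma prod_arc_faces:
  assumes s: "s \<in> {1, -1 :: real}" and P: "noncrossing_matching {0..<2 * k} P"
  shows "(\<Prod>F\<in>arc_face s (arcs P) ` arcs P. W (\<Sum>i\<in>face_indices k F. l i)) =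
     (\<Prod>p\<in>arcs P. W (\<Sum>i\<in>visible (arcs P) p. l i :: nat) :: real)"
proof -
  have lam: "laminar (arcs P)" by (rule laminar_arcs[OF P])
  have sub: "arcs P \<subseteq> {0..<2 * k} \<times> {0..<2 * k}" by (rule arcs_subset[OF P])
  then have fin: "finite (arcs P)" by (rule finite_subset) simp
  have inj: "inj_on (arc_face s (arcs P)) (arcs P)"
  proof (rule inj_onI)
    fix p q assume pq: "p \<in> arcs P" "q \<in> arcs P" "arc_face s (arcs P) p = arc_face s (arcs P) q"
    have "arc_face s (arcs P) p \<noteq> {}"
      using arc_face_nonempty[OF s laminarD[OF lam], of "arcs P" "fst p" "snd p"] pq(1) by simp
    then show "p = q" using arc_face_disjoint[OF lam pq(1,2), of s] pq(3) by blast
  qed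
  have "face_indices k (arc_face s (arcs P) p) = visible (arcs P) p" if p: "p \<in> arcs P" for p
  proof -
    obtain a b where ab: "p = (a, b)" by fastforce
    \<comment> \<open>A gap below an arc ends at most at \<open>2 * k - 1\<close>, so the index
      range in \<open>face_indices\<close> cuts nothing off.\<close>
    have "b < 2 * k" using sub p ab by auto
    then have "visible (arcs P) p \<subseteq> {0..2 * k - 2}" by (auto simp: visible_def ab)
    moreover have "closed_segment (of_nat i) (of_nat (i + 1)) \<subseteq> frontier (arc_face s (arcs P) p) \<longleftrightarrow> i \<in> visible (arcs P) p" for i
      using segment_subset_frontier_arc_face_iff[OF s laminarD[OF lam] fin, of a b i] p ab by simp
    ultimately show ?thesis unfolding face_indices_def by blast
  qed
  then show ?thesis by (simp add: prod.reindex[OF inj])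
qed

lemma face_weight_eq:
  assumes C1: "noncrossing_matching {0..<2 * k} (fst C)" and C2: "noncrossing_matching {0..<2 * k} (snd C)"
  shows "face_weight k C l =
    (\<Prod>p\<in>arcs (fst C). arc_weight (\<Sum>i\<in>visible (arcs (fst C)) p. l i)) *
    (\<Prod>p\<in>arcs (snd C). arc_weight (\<Sum>i\<in>visible (arcs (snd C)) p. l i))"
proof -
  have fin: "finite (arcs (fst C))" "finite (arcs (snd C))"
    using finite_subset[OF arcs_subset] C1 C2 by blast+
  have "X \<inter> Y = {} \<and> X \<noteq> {}" if X: "X \<in> arc_face 1 (arcs (fst C)) ` arcs (fst C)" and "Y \<in> arc_face (-1) (arcs (snd C)) ` arcs (snd C)" for X Y
  proof -
    have "X \<noteq> {}" using X arc_face_nonempty[OF _ laminarD[OF laminar_arcs[OF C1]], of 1] by fastforce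
    moreover have "X \<subseteq> {z. Im z > 0}" "Y \<subseteq> {z. Im z < 0}" using that by (auto simp: arc_face_def)
    ultimately show ?thesis by fastforce
  qed
  then have "arc_face 1 (arcs (fst C)) ` arcs (fst C) \<inter> arc_face (-1) (arcs (snd C)) ` arcs (snd C) = {}"
    by blast
  then show ?thesis
    unfolding face_weight_def faces_eq[OF C1 C2 finite_atLeastLessThan] Let_def arc_weight_def[symmetric]
    using prod_arc_faces[OF _ C1, of 1 arc_weight l] prod_arc_faces[OF _ C2, of "-1" arc_weight l] fin
    by (subst prod.union_disjoint) auto
qed

section \<open>Matchings and excursions\<close>

definition partner :: "'a set set \<Rightarrow> 'a \<Rightarrow> 'a" where
  "partner P x = (SOME y. y \<noteq> x \<and> {x, y} \<in> P)"

context
  fixes A :: "'a::linorder set" and P :: "'a set set"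
  assumes P: "noncrossing_matching A P"
begin

lemma partner_props:
  assumes "x \<in> A"
  shows "{x, partner P x} \<in> P" "partner P x \<noteq> x"
proof -
  have "\<exists>y. y \<noteq> x \<and> {x, y} \<in> P" using noncrossing_matching_partner_exists[OF P assms] by blast
  from someI_ex[OF this] show "{x, partner P x} \<in> P" "partner P x \<noteq> x" unfolding partner_def by auto
qed

lemma partner_in: "x \<in> A \<Longrightarrow> partner P x \<in> A"
  using noncrossing_matching_pairD(2)[OF P partner_props(1)] .

lemma partner_eqI: "{x, y} \<in> P \<Longrightarrow> partner P x = y"
  using noncrossing_matching_partner_unique[OF P partner_props(1)] noncrossing_matching_pairD(1)[OF P] by blast

lemma partner_partner: "x \<in> A \<Longrightarrow> partner P (partner P x) = x"
  using partner_eqI[of "partner P x" x] partner_props(1) by (simp add: insert_commute)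

lemma encodes_L_iff: "encodes A w P \<Longrightarrow> x \<in> A \<Longrightarrow> w x = L \<longleftrightarrow> x < partner P x"
  unfolding encodes_def using partner_props(1) partner_eqI by metis

lemma step_partner:
  assumes "encodes A w P" "x \<in> A"
  shows "step (w (partner P x)) = - step (w x)"
  using encodes_L_iff[OF assms] encodes_L_iff[OF assms(1) partner_in[OF assms(2)]]
    partner_partner[OF assms(2)] partner_props(2)[OF assms(2)]
  by (cases "w x"; cases "w (partner P x)") auto

text \<open>The involution \<open>partner P\<close> reverses the sign of every step, so the sum is
  its own negative.\<close>

lemma sum_step_closed:
  assumes "encodes A w P" "B \<subseteq> A" "\<And>x. x \<in> B \<Longrightarrow> partner P x \<in> B"
  shows "(\<Sum>x\<in>B. step (w x)) = 0"
proof -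
  have "(\<Sum>x\<in>B. step (w x)) = (\<Sum>x\<in>B. step (w (partner P x)))"
    using assms(2,3) partner_partner
    by (intro sum.reindex_bij_witness[of _ "partner P" "partner P"]) auto
  also have "\<dots> = - (\<Sum>x\<in>B. step (w x))"
    using step_partner[OF assms(1)] assms(2) by (simp add: subset_iff sum_negf[symmetric])
  finally show ?thesis by simp
qed

lemma noncrossing_interval_closed:
  assumes "{i, j} \<in> P" "i < j" "x \<in> A" "i \<le> x" "x \<le> j"
  shows "i \<le> partner P x \<and> partner P x \<le> j"
proof (cases "x = i \<or> x = j")
  case True
  then show ?thesis using partner_eqI[of i j] partner_eqI[of j i] assms by (auto simp: insert_commute)
next
  case False
  then have x: "i < x" "x < j" using assms by auto
  have cr: "\<not> (i < j \<and> j < k \<and> k < l \<and> {i, k} \<in> P \<and> {j, l} \<in> P)" for i j k l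
    using P unfolding noncrossing_matching_def by blast
  have "{x, partner P x} \<in> P" "{partner P x, x} \<in> P"
    using partner_props(1)[OF assms(3)] by (simp_all add: insert_commute)
  then show ?thesis
    using cr[of "partner P x" i x j] cr[of i x j "partner P x"] x assms(1) by force
qed

text \<open>The height after \<open>t\<close> is the number of arcs that are open at
  \<open>t\<close>, and the arc starting at \<open>i\<close> stays open until
  \<open>j\<close>.\<close>

lemma excursion_if_matched:
  assumes enc: "encodes A w P" and ij: "{i, j} \<in> P" "i < j" and fin: "finite (A \<inter> {i..j})"
  shows "excursion w (A \<inter> {i..j})"
  unfolding excursion_def passage_def
proof (intro conjI ballI impI)
  have A: "i \<in> A" "j \<in> A" using noncrossing_matching_pairD[OF P ij(1)] by auto
  then show "A \<inter> {i..j} \<noteq> {}" using ij by auto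
  have closed: "partner P x \<in> A \<inter> {i..j}" if "x \<in> A \<inter> {i..j}" for x
    using that noncrossing_interval_closed[OF ij] partner_in by auto
  then show "0 + (\<Sum>x\<in>A \<inter> {i..j}. step (w x)) = 0"
    using sum_step_closed[OF enc Int_lower1 closed] by simp
  fix t assume t: "t \<in> A \<inter> {i..j}" "\<exists>u\<in>A \<inter> {i..j}. t < u"
  then have tj: "t < j" by force
  define B where "B = {x \<in> A \<inter> {i..j}. x \<le> t}"
  have finB: "finite B" unfolding B_def by (rule finite_subset[OF _ fin]) auto
  have BA: "B \<subseteq> A" by (auto simp: B_def)
  \<comment> \<open>Pairs contained in the prefix cancel. A point whose partner is missing has it to
    the right of \<open>t\<close>, since partners stay in the interval, so it carries
    \<open>L\<close>.\<close>
  define B1 B2 where "B1 = {x\<in>B. partner P x \<in> B}" and "B2 = {x\<in>B. partner P x \<notin> B}"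
  have "(\<Sum>x\<in>B1. step (w x)) = 0"
    using BA partner_partner by (intro sum_step_closed[OF enc]) (auto simp: B1_def subset_iff)
  moreover have "step (w x) = 1" if "x \<in> B2" for x
  proof -
    have "x \<in> A \<inter> {i..j}" "x \<le> t" "\<not> partner P x \<le> t"
      using that closed[of x] by (auto simp: B2_def B_def)
    then have "w x = L" using encodes_L_iff[OF enc, of x] by auto
    then show ?thesis by simp
  qed
  moreover have "B = B1 \<union> B2" "B1 \<inter> B2 = {}" "finite B1" "finite B2" using finB by (auto simp: B1_def B2_def)
  ultimately have "(\<Sum>x\<in>B. step (w x)) = int (card B2)" by (simp add: sum.union_disjoint)
  moreover have "i \<in> B2"
    using A ij tj t partner_eqI[OF ij(1)] by (auto simp: B2_def B_def)
  ultimately show "0 < 0 + (\<Sum>x\<in>{x \<in> A \<inter> {i..j}. x \<le> t}. step (w x))"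
    unfolding B_def[symmetric] using \<open>finite B2\<close> by (auto simp: card_gt_0_iff)
qed

end

lemma excursion_sum_eq_0: "excursion w S \<Longrightarrow> (\<Sum>x\<in>S. step (w x)) = 0"
  by (simp add: excursion_def passage_def)

lemma excursion_sum_pos:
  "excursion w S \<Longrightarrow> t \<in> S \<Longrightarrow> u \<in> S \<Longrightarrow> t < u \<Longrightarrow> 0 < (\<Sum>x\<in>{x \<in> S. x \<le> t}. step (w x))"
  by (auto simp: excursion_def passage_def)

lemma excursion_first:
  assumes "excursion w (A \<inter> {i..j})" "i < j" "i \<in> A" "j \<in> A"
  shows "w i = L"
proof -
  have "{x \<in> A \<inter> {i..j}. x \<le> i} = {i}" using assms by auto
  then show ?thesis using excursion_sum_pos[OF assms(1), of i j] assms(2-) by (cases "w i") auto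
qed

text \<open>A longer excursion from the same start would be at height 0 before its end.\<close>

lemma excursion_right_unique:
  assumes "excursion w (A \<inter> {i..j})" "excursion w (A \<inter> {i..j'})" "i < j" "j \<in> A" "j' \<in> A"
  shows "j' \<le> j"
proof (rule ccontr)
  assume "\<not> j' \<le> j"
  then have j: "j < j'" by simp
  then have "{x \<in> A \<inter> {i..j'}. x \<le> j} = A \<inter> {i..j}" by auto
  moreover have "0 < (\<Sum>x\<in>{x \<in> A \<inter> {i..j'}. x \<le> j}. step (w x))"
    using assms(3-) j by (intro excursion_sum_pos[OF assms(2), of j j']) auto
  ultimately show False using excursion_sum_eq_0[OF assms(1)] by simp
qed

text \<open>The total is 0 and the part before \<open>i'\<close>, which ends at
  \<open>Max S\<close>, has positive sum. This is the time-reversed form of positivity, used for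
  right ends and for crossings.\<close>

lemma excursion_suffix_sum_neg:
  fixes A :: "'a::linorder set"
  assumes exc: "excursion w (A \<inter> {i..j})" and fin: "finite (A \<inter> {i..j})"
    and i: "i \<in> A" "i < i'" "i' \<le> j" "i' \<in> A"
  shows "(\<Sum>x\<in>A \<inter> {i'..j}. step (w x)) < 0"
proof -
  define S where "S = {x \<in> A \<inter> {i..j}. x < i'}"
  have "finite S" unfolding S_def by (rule finite_subset[OF _ fin]) auto
  moreover have "i \<in> S" using i by (auto simp: S_def)
  ultimately have S: "finite S" "S \<noteq> {}" by auto
  have t: "Max S \<in> S" using S by simp
  have "x \<in> S \<longleftrightarrow> x \<in> A \<inter> {i..j} \<and> x \<le> Max S" for x
    using Max_ge[OF S(1), of x] t by (auto simp: S_def)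
  then have "{x \<in> A \<inter> {i..j}. x \<le> Max S} = S" by blast
  moreover have "0 < (\<Sum>x\<in>{x \<in> A \<inter> {i..j}. x \<le> Max S}. step (w x))"
    using t i by (intro excursion_sum_pos[OF exc, of "Max S" i']) (simp_all add: S_def)
  ultimately have "0 < (\<Sum>x\<in>S. step (w x))" by simp
  moreover have "A \<inter> {i..j} = S \<union> (A \<inter> {i'..j})" "S \<inter> (A \<inter> {i'..j}) = {}"
    using i by (auto simp: S_def)
  moreover have "finite (A \<inter> {i'..j})" by (rule finite_subset[OF _ fin]) (use i in auto)
  ultimately show ?thesis using excursion_sum_eq_0[OF exc] S by (simp add: sum.union_disjoint)
qed

lemma excursion_left_unique:
  fixes A :: "'a::linorder set"
  assumes "excursion w (A \<inter> {i..j})" "excursion w (A \<inter> {i'..j})" "finite (A \<inter> {i..j})" "i \<in> A" "i' \<in> A" "i' \<le> j"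
  shows "i' \<le> i"
proof (rule ccontr)
  assume "\<not> i' \<le> i"
  then have "i < i'" by simp
  then show False
    using excursion_suffix_sum_neg[OF assms(1,3,4) _ assms(6,5)] excursion_sum_eq_0[OF assms(2)] by simp
qed

text \<open>The link between matchings and words. From right to left: the first letter is
  \<open>L\<close>, so \<open>i\<close> has a partner to its right, which also closes an excursion
  from \<open>i\<close>; right ends of excursions are unique.\<close>

lemma matched_iff_excursion:
  assumes P: "noncrossing_matching A P" and enc: "encodes A w P" and fin: "\<And>i j. finite (A \<inter> {i..j})"
    and ij: "i \<in> A" "j \<in> A" "i < j"
  shows "{i, j} \<in> P \<longleftrightarrow> excursion w (A \<inter> {i..j})"
proof
  assume exc: "excursion w (A \<inter> {i..j})"
  then have "i < partner P i" using excursion_first ij encodes_L_iff[OF P enc] by blast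
  then have "excursion w (A \<inter> {i..partner P i})"
    using excursion_if_matched[OF P enc _ _ fin] partner_props[OF P ij(1)] by blast
  then have "partner P i = j"
    using excursion_right_unique[of w A i] exc \<open>i < partner P i\<close> ij partner_in[OF P] by (meson order_antisym)
  then show "{i, j} \<in> P" using partner_props[OF P ij(1)] by simp
qed (use excursion_if_matched[OF P enc _ ij(3) fin] in blast)

lemma matching_subset_if_encodes:
  assumes P: "noncrossing_matching A P" "encodes A w P" and Q: "noncrossing_matching A Q" "encodes A w Q"
    and fin: "\<And>i j. finite (A \<inter> {i..j})"
  shows "P \<subseteq> Q"
proof
  fix p assume p: "p \<in> P"
  then have "card p = 2" using P(1) by (simp add: noncrossing_matching_def)
  then obtain x y where xy: "p = {x, y}" "x \<noteq> y" by (auto simp: card_2_iff)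
  define i j where "i = min x y" and "j = max x y"
  have ij: "p = {i, j}" "i < j" using xy by (auto simp: i_def j_def min_def max_def)
  then have "i \<in> A" "j \<in> A" using noncrossing_matching_pairD[OF P(1)] p by auto
  then show "p \<in> Q"
    using matched_iff_excursion[OF P fin] matched_iff_excursion[OF Q fin] ij p by blast
qed

lemma matching_unique:
  assumes "noncrossing_matching A P" "encodes A w P" "noncrossing_matching A Q" "encodes A w Q"
    and "\<And>i j. finite (A \<inter> {i..j})"
  shows "P = Q"
  using matching_subset_if_encodes[OF assms(1-4)] matching_subset_if_encodes[OF assms(3,4,1,2)] assms(5) by blast

section \<open>Words that have a matching\<close>

text \<open>Phrased by finite windows instead of matchings, so that measurability and almost sure
  validity can be checked letter by letter.\<close>

definition matched_word :: "(int \<Rightarrow> letter) \<Rightarrow> bool" where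
  "matched_word w \<longleftrightarrow> (\<forall>i. (w i = L \<longrightarrow> (\<exists>j>i. excursion w {i..j})) \<and> (w i = R \<longrightarrow> (\<exists>j<i. excursion w {j..i})))"

lemma excursion_last:
  fixes w :: "int \<Rightarrow> letter"
  assumes "excursion w {i..j}" "i < j"
  shows "w j = R"
proof -
  have "(\<Sum>x\<in>{j..j}. step (w x)) < 0"
    using excursion_suffix_sum_neg[of w UNIV i j j] assms by simp
  then show ?thesis by (cases "w j") auto
qed

text \<open>To build the matching, the ends of every excursion interval are paired. Two pairs cannot
  share a point: left ends carry \<open>L\<close>, right ends \<open>R\<close>, and each end
  determines the other.\<close>

lemma matched_word_iff: "matched_word w \<longleftrightarrow> (\<exists>P. noncrossing_matching UNIV P \<and> encodes UNIV w P)"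
proof
  assume "\<exists>P. noncrossing_matching UNIV P \<and> encodes UNIV w P"
  then obtain P where P: "noncrossing_matching UNIV P" and enc: "encodes UNIV w P" by blast
  show "matched_word w" unfolding matched_word_def
  proof (intro allI conjI impI)
    fix i
    note pp = partner_props[OF P, of i, simplified]
    { assume "w i = L"
      then have "i < partner P i" using encodes_L_iff[OF P enc, of i] by simp
      then show "\<exists>j>i. excursion w {i..j}"
        using excursion_if_matched[OF P enc pp(1)] by auto }
    { assume "w i = R"
      then have lt: "partner P i < i" using encodes_L_iff[OF P enc, of i] pp(2) by force
      moreover have "{partner P i, i} \<in> P" using pp(1) by (simp add: insert_commute)
      ultimately show "\<exists>j<i. excursion w {j..i}"
        using excursion_if_matched[OF P enc _ lt] by auto }
  qed
next
  assume mw: "matched_word w"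
  have first: "w i = L" and last: "w j = R" if "excursion w {i..j}" "i < j" for i j
    using excursion_first[of w UNIV i j] excursion_last[of w i j] that by auto
  have ru: "j = j'" if "excursion w {i..j}" "excursion w {i..j'}" "i < j" "i < j'" for i j j'
    using excursion_right_unique[of w UNIV i j j'] excursion_right_unique[of w UNIV i j' j] that by simp
  have lu: "i = i'" if "excursion w {i..j}" "excursion w {i'..j}" "i < j" "i' < j" for i j i'
    using excursion_left_unique[of w UNIV i j i'] excursion_left_unique[of w UNIV i' j i] that by simp
  define P where "P = {{i, j} | i j. i < j \<and> excursion w {i..j}}"
  have P_iff: "{i, j} \<in> P \<longleftrightarrow> excursion w {i..j}" if "i < j" for i j
    using that by (auto simp: P_def doubleton_eq_iff)
  have "partition_on UNIV P"
    unfolding partition_on_def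
  proof (intro conjI)
    show "\<Union>P = UNIV"
    proof -
      have "\<exists>p\<in>P. i \<in> p" for i
      proof (cases "w i")
        case L
        then obtain j where "i < j" "excursion w {i..j}" using mw unfolding matched_word_def by blast
        then have "{i, j} \<in> P" using P_iff by simp
        then show ?thesis by blast
      next
        case R
        then obtain j where "j < i" "excursion w {j..i}" using mw unfolding matched_word_def by blast
        then have "{j, i} \<in> P" using P_iff by simp
        then show ?thesis by blast
      qed
      then show ?thesis by blast
    qed
    show "{} \<notin> P" by (auto simp: P_def)
    show "disjoint P"
    proof (rule disjointI)
      fix p q assume p: "p \<in> P" and q: "q \<in> P" and ne: "p \<noteq> q"
      obtain i j where ij: "p = {i, j}" "i < j" "excursion w {i..j}" using p by (auto simp: P_def)
      obtain k l where kl: "q = {k, l}" "k < l" "excursion w {k..l}" using q by (auto simp: P_def)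
      have "w i = L" "w j = R" "w k = L" "w l = R" using first last ij kl by auto
      then have "i \<noteq> l" "j \<noteq> k" by auto
      moreover have "i \<noteq> k" using ru[of i j l] ij kl ne by auto
      moreover have "j \<noteq> l" using lu[of i j k] ij kl ne by auto
      ultimately show "p \<inter> q = {}" using ij kl by auto
    qed
  qed
  moreover have "\<forall>p\<in>P. card p = 2" by (auto simp: P_def)
  moreover have "\<not> (\<exists>i j k l. i < j \<and> j < k \<and> k < l \<and> {i, k} \<in> P \<and> {j, l} \<in> P)"
  proof
    assume "\<exists>i j k l. i < j \<and> j < k \<and> k < l \<and> {i, k} \<in> P \<and> {j, l} \<in> P"
    then obtain i j k l where *: "i < j" "j < k" "k < l" "{i, k} \<in> P" "{j, l} \<in> P" by blast
    then have "excursion w {i..k}" "excursion w {j..l}" using P_iff[of i k] P_iff[of j l] by auto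
    \<comment> \<open>For crossing pairs the overlap \<open>{j..k}\<close> is a proper suffix of one
      excursion and a proper prefix of the other, so its sum would be both negative and
      positive.\<close>
    then have "(\<Sum>x\<in>{j..k}. step (w x)) < 0" "0 < (\<Sum>x\<in>{x\<in>{j..l}. x \<le> k}. step (w x))"
      using excursion_suffix_sum_neg[of w UNIV i k j] excursion_sum_pos[of w "{j..l}" k l] * by auto
    moreover have "{x\<in>{j..l}. x \<le> k} = {j..k}" using * by auto
    ultimately show False by simp
  qed
  ultimately have "noncrossing_matching UNIV P" by (simp add: noncrossing_matching_def)
  moreover have "encodes UNIV w P"
    unfolding encodes_def using mw first P_iff unfolding matched_word_def by (metis letter.distinct(1))
  ultimately show "\<exists>P. noncrossing_matching UNIV P \<and> encodes UNIV w P" by blast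
qed

text \<open>An auxiliary word encoding \<open>P\<close> makes the points from \<open>a\<close> to
  \<open>b\<close> an excursion, so their number is even.\<close>

lemma odd_arc:
  assumes "noncrossing_matching {0..<n} P" "(a, b) \<in> arcs P"
  shows "odd (int b - int a)"
proof -
  define w where "w i = (if \<exists>j. i < j \<and> {i, j} \<in> P then L else R)" for i
  have "encodes {0..<n} w P" by (auto simp: encodes_def w_def)
  moreover have ab: "{a, b} \<in> P" "a < b" using assms(2) by (auto simp: arcs_def)
  ultimately have "excursion w ({0..<n} \<inter> {a..b})"
    using excursion_if_matched[OF assms(1)] by blast
  moreover have "{0..<n} \<inter> {a..b} = {a..b}"
    using noncrossing_matching_pairD[OF assms(1) ab(1)] by auto
  ultimately have "even (card {a..b})"
    using even_card_if_sum_step_eq_0[OF _ excursion_sum_eq_0] by (metis finite_atLeastAtMost)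
  then show ?thesis using ab by (simp add: Suc_diff_le)
qed

section \<open>Realising a meander in the noodle\<close>

text \<open>A condition on finitely many letters when \<open>P\<close> is finite; no matching of the
  integers is involved, so that it can be given a probability for each fixed
  \<open>f\<close>.\<close>

definition linked :: "(int \<Rightarrow> letter) \<Rightarrow> (nat \<Rightarrow> int) \<Rightarrow> nat set set \<Rightarrow> bool" where
  "linked w f P \<longleftrightarrow> (\<forall>(a, b)\<in>arcs P. excursion w {f a..f b})"

text \<open>Exactly \<open>2 * l i\<close> integers lie strictly between the positions of the points
  \<open>i\<close> and \<open>i + 1\<close>, and the point \<open>m\<close> is placed at 0. The
  formula makes sense for all \<open>i\<close>, which gives a map that is strictly increasing
  everywhere.\<close>

definition pos :: "nat \<Rightarrow> (nat \<Rightarrow> nat) \<Rightarrow> nat \<Rightarrow> int" where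
  "pos m l i = int (\<Sum>j<i. 2 * l j + 1) - int (\<Sum>j<m. 2 * l j + 1)"

lemma pos_self [simp]: "pos m l m = 0"
  by (simp add: pos_def)

lemma pos_Suc: "pos m l (Suc i) = pos m l i + 2 * int (l i) + 1"
  by (simp add: pos_def)

lemma strict_mono_pos: "strict_mono (pos m l)"
  by (rule strict_mono_Suc_iff[THEN iffD2]) (simp add: pos_Suc)

lemma matching_pair_arcs:
  assumes "noncrossing_matching A P" "{x, y} \<in> P"
  shows "(x, y) \<in> arcs P \<or> (y, x) \<in> arcs P"
  using assms noncrossing_matching_pairD(3)[OF assms] by (auto simp: arcs_def insert_commute)

lemma linked_iff_subset:
  assumes P: "noncrossing_matching A P" and Q: "noncrossing_matching UNIV Q" "encodes UNIV w Q"
    and f: "strict_mono_on A f"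
  shows "linked w f P \<longleftrightarrow> (\<forall>x y. {x, y} \<in> P \<longrightarrow> {f x, f y} \<in> Q)"
proof -
  have iff: "excursion w {f a..f b} \<longleftrightarrow> {f a, f b} \<in> Q" if "(a, b) \<in> arcs P" for a b
  proof -
    have "a \<in> A" "b \<in> A" "a < b" using that arcs_subset[OF P] by (auto simp: arcs_def)
    then have "f a < f b" using f by (auto simp: strict_mono_on_def)
    then show ?thesis using matched_iff_excursion[OF Q, of "f a" "f b"] by simp
  qed
  show ?thesis
  proof
    assume l: "linked w f P"
    show "\<forall>x y. {x, y} \<in> P \<longrightarrow> {f x, f y} \<in> Q"
    proof (intro allI impI)
      fix x y assume "{x, y} \<in> P"
      then have "(x, y) \<in> arcs P \<or> (y, x) \<in> arcs P" by (rule matching_pair_arcs[OF P])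
      then show "{f x, f y} \<in> Q"
        using l iff unfolding linked_def by (auto simp: insert_commute)
    qed
  next
    assume *: "\<forall>x y. {x, y} \<in> P \<longrightarrow> {f x, f y} \<in> Q"
    have "excursion w {f a..f b}" if "(a, b) \<in> arcs P" for a b
      using iff[OF that] * that by (auto simp: arcs_def)
    then show "linked w f P" unfolding linked_def by blast
  qed
qed

lemma noncrossing_matching_Union: "noncrossing_matching A P \<Longrightarrow> \<Union>P = A"
  by (simp add: noncrossing_matching_def partition_on_def)

text \<open>A vertex has just one neighbour in each matching, and for an image point both are images
  of its partners in \<open>C\<close>.\<close>

lemma adjacent_closed:
  fixes n :: nat
  assumes C: "noncrossing_matching {0..<n} (fst C)" "noncrossing_matching {0..<n} (snd C)"
    and P: "noncrossing_matching UNIV P" and Q: "noncrossing_matching UNIV Q"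
    and fP: "\<And>x y. {x, y} \<in> fst C \<Longrightarrow> {f x, f y} \<in> P" and fQ: "\<And>x y. {x, y} \<in> snd C \<Longrightarrow> {f x, f y} \<in> Q"
    and adj: "adjacent P Q x y" and x: "x \<in> f ` {0..<n}"
  shows "y \<in> f ` {0..<n}"
proof -
  obtain a where a: "a < n" "x = f a" using x by auto
  have "a \<in> {0..<n}" using a by simp
  then obtain b c where b: "b < n" "{a, b} \<in> fst C" and c: "c < n" "{a, c} \<in> snd C"
    using noncrossing_matching_partner_exists[OF C(1)] noncrossing_matching_partner_exists[OF C(2)]
    by (meson atLeastLessThan_iff)
  have "y = f b \<or> y = f c"
    using adj noncrossing_matching_partner_unique[OF P, of x y "f b"] fP[OF b(2)]
      noncrossing_matching_partner_unique[OF Q, of x y "f c"] fQ[OF c(2)] a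
    unfolding adjacent_def by auto
  then show ?thesis using b c by auto
qed

text \<open>The component cannot leave the image by \<open>adjacent_closed\<close>, and it fills the
  image because paths in the connected graph of \<open>C\<close> are carried over by
  \<open>f\<close>.\<close>

lemma graph_component_image:
  assumes C: "meander k C"
    and P: "noncrossing_matching UNIV P" and Q: "noncrossing_matching UNIV Q"
    and fP: "\<And>x y. {x, y} \<in> fst C \<Longrightarrow> {f x, f y} \<in> P" and fQ: "\<And>x y. {x, y} \<in> snd C \<Longrightarrow> {f x, f y} \<in> Q"
    and m: "m < 2 * k"
  shows "graph_component P Q (f m) = f ` {0..<2 * k}"
proof
  have nc: "noncrossing_matching {0..<2 * k} (fst C)" "noncrossing_matching {0..<2 * k} (snd C)"
    using C by (auto simp: meander_def meandric_system_def)
  have "y \<in> f ` {0..<2 * k}" if "(adjacent P Q)\<^sup>*\<^sup>* (f m) y" for y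
    using that
  proof (induction rule: rtranclp_induct)
    case base
    then show ?case using m by simp
  next
    case (step y z)
    then show ?case using adjacent_closed[OF nc P Q, of f y z] fP fQ by blast
  qed
  then show "graph_component P Q (f m) \<subseteq> f ` {0..<2 * k}" by (auto simp: graph_component_def)
  have "(adjacent P Q)\<^sup>*\<^sup>* (f m) (f y)" if "(adjacent (fst C) (snd C))\<^sup>*\<^sup>* m y" for y
    using that
  proof (induction rule: rtranclp_induct)
    case (step y z)
    then have "adjacent P Q (f y) (f z)" using fP fQ by (auto simp: adjacent_def)
    then show ?case using step.IH by simp
  qed simp
  moreover have "(adjacent (fst C) (snd C))\<^sup>*\<^sup>* m y" if "y < 2 * k" for y
    using C m that by (auto simp: meander_def graph_component_def)
  ultimately show "f ` {0..<2 * k} \<subseteq> graph_component P Q (f m)" by (auto simp: graph_component_def)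
qed

lemma even_gaps:
  fixes f :: "nat \<Rightarrow> int"
  assumes C: "meander k C"
    and odd: "\<And>a b. (a, b) \<in> arcs (fst C) \<union> arcs (snd C) \<Longrightarrow> odd (f b - f a)"
    and xy: "x < 2 * k" "y < 2 * k"
  shows "even ((f y - int y) - (f x - int x))"
proof -
  have nc: "noncrossing_matching {0..<2 * k} (fst C)" "noncrossing_matching {0..<2 * k} (snd C)"
    using C by (auto simp: meander_def meandric_system_def)
  have "(adjacent (fst C) (snd C))\<^sup>*\<^sup>* x y"
    using C xy by (auto simp: meander_def graph_component_def)
  then show ?thesis
  proof (induction rule: rtranclp_induct)
    case (step y z)
    have "(y, z) \<in> arcs (fst C) \<union> arcs (snd C) \<or> (z, y) \<in> arcs (fst C) \<union> arcs (snd C)"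
      using step.hyps(2) matching_pair_arcs[OF nc(1)] matching_pair_arcs[OF nc(2)] by (auto simp: adjacent_def)
    then have "odd (f z - f y)" "odd (int z - int y)"
      using odd[of y z] odd[of z y] odd_arc[OF nc(1), of y z] odd_arc[OF nc(1), of z y]
        odd_arc[OF nc(2), of y z] odd_arc[OF nc(2), of z y] by auto
    then show ?case using step.IH by (auto simp: even_diff)
  qed simp
qed

lemma odd_excursion_length:
  fixes i j :: int
  assumes "excursion w {i..j}" "i < j"
  shows "odd (j - i)"
proof -
  have "even (card {i..j})"
    using even_card_if_sum_step_eq_0[OF _ excursion_sum_eq_0[OF assms(1)]] by simp
  then show ?thesis using assms(2) by (simp add: even_nat_iff)
qed

lemma ex_pos_if_odd_gaps:
  fixes f :: "nat \<Rightarrow> int"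
  assumes mono: "\<And>i. Suc i < n \<Longrightarrow> f i < f (Suc i)" and odd: "\<And>i. Suc i < n \<Longrightarrow> odd (f (Suc i) - f i)"
    and m: "m < n" "f m = 0"
  obtains l where "l \<in> {0..n - 2} \<rightarrow>\<^sub>E UNIV" "\<And>i. i < n \<Longrightarrow> f i = pos m l i"
proof -
  \<comment> \<open>A difference \<open>2 * d + 1\<close> leaves \<open>2 * d\<close> points in the
    gap, and halving recovers \<open>d\<close>; \<open>restrict\<close> yields the representative in
    the function space.\<close>
  define l where "l = restrict (\<lambda>i. nat ((f (Suc i) - f i) div 2)) {0..n - 2}"
  have Suc: "f (Suc i) = f i + 2 * int (l i) + 1" if "Suc i < n" for i
  proof -
    have "l i = nat ((f (Suc i) - f i) div 2)" using that by (auto simp: l_def)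
    moreover have "odd (f (Suc i) - f i)" using odd that by blast
    then obtain d where d: "f (Suc i) - f i = 2 * d + 1" by (rule oddE)
    moreover have "0 \<le> d" using mono[OF that] d by linarith
    ultimately show ?thesis by simp
  qed
  have "f i - f 0 = pos m l i - pos m l 0" if "i < n" for i
    using that by (induction i) (simp_all add: Suc pos_Suc)
  from this[of m] this have "f i = pos m l i" if "i < n" for i using m that by force
  moreover have "l \<in> {0..n - 2} \<rightarrow>\<^sub>E UNIV" by (simp add: l_def)
  ultimately show ?thesis using that by blast
qed

text \<open>Both maps list their common image in increasing order.\<close>

lemma strict_mono_on_image_unique:
  fixes f g :: "nat \<Rightarrow> 'a::linorder"
  assumes f: "strict_mono_on {0..<n} f" and g: "strict_mono_on {0..<n} g" and eq: "f ` {0..<n} = g ` {0..<n}"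
    and i: "i < n"
  shows "f i = g i"
proof -
  have *: "map h [0..<n] = sorted_list_of_set (h ` {0..<n})" if h: "strict_mono_on {0..<n} h" for h :: "nat \<Rightarrow> 'a"
  proof (rule sorted_distinct_set_unique)
    have "h i \<le> h j" if "i \<le> j" "j < n" for i j
      using strict_mono_onD[OF h, of i j] that by (cases "i = j") auto
    then show "sorted (map h [0..<n])" by (simp add: sorted_iff_nth_mono)
    show "distinct (map h [0..<n])" using strict_mono_on_imp_inj_on[OF h] by (simp add: distinct_map)
  qed simp_all
  have "map f [0..<n] = map g [0..<n]" using *[OF f] *[OF g] eq by simp
  then show ?thesis using i by (auto dest: arg_cong[where f = "\<lambda>xs. xs ! i"])
qed

text \<open>\<open>m\<close> is recovered as the index placed at 0, and \<open>l\<close> from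
  consecutive differences.\<close>

lemma pos_unique:
  assumes n: "n \<ge> 2" and eq: "\<And>i. i < n \<Longrightarrow> pos m l i = pos m' l' i" and m: "m < n"
    and l: "l \<in> {0..n - 2} \<rightarrow>\<^sub>E UNIV" "l' \<in> {0..n - 2} \<rightarrow>\<^sub>E UNIV"
  shows "m = m'" "l = l'"
proof -
  have "pos m' l' m = pos m' l' m'" using eq[OF m] by simp
  then show "m = m'" using strict_mono_eq[OF strict_mono_pos] by blast
  show "l = l'"
  proof (rule PiE_ext[OF l])
    fix i assume "i \<in> {0..n - 2}"
    then have "i < n" "Suc i < n" using n by auto
    then show "l i = l' i" using eq[of i] eq[of "Suc i"] by (simp add: pos_Suc)
  qed
qed

text \<open>Both images are the component of 0 in the same noodle. This makes the events for
  different \<open>m\<close> and \<open>l\<close> disjoint, provided that the matchings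
  exist.\<close>

lemma linked_pos_unique:
  assumes k: "k \<ge> 1" and C: "meander k C" and w: "matched_word wa" "matched_word wb"
    and m: "m < 2 * k" "m' < 2 * k"
    and l: "l \<in> {0..2 * k - 2} \<rightarrow>\<^sub>E UNIV" "l' \<in> {0..2 * k - 2} \<rightarrow>\<^sub>E UNIV"
    and 1: "linked wa (pos m l) (fst C)" "linked wb (pos m l) (snd C)"
    and 2: "linked wa (pos m' l') (fst C)" "linked wb (pos m' l') (snd C)"
  shows "m = m' \<and> l = l'"
proof -
  have nc: "noncrossing_matching {0..<2 * k} (fst C)" "noncrossing_matching {0..<2 * k} (snd C)"
    using C by (auto simp: meander_def meandric_system_def)
  obtain P Q where P: "noncrossing_matching UNIV P" "encodes UNIV wa P"
    and Q: "noncrossing_matching UNIV Q" "encodes UNIV wb Q"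
    using w unfolding matched_word_iff by blast
  have mono: "strict_mono_on A (pos m l)" for A m l
    by (auto intro!: strict_mono_onI strict_monoD[OF strict_mono_pos])
  have "graph_component P Q 0 = pos m l ` {0..<2 * k}" if "m < 2 * k" "linked wa (pos m l) (fst C)" "linked wb (pos m l) (snd C)" for m l
    using graph_component_image[OF C P(1) Q(1), of "pos m l" m]
      linked_iff_subset[OF nc(1) P mono] linked_iff_subset[OF nc(2) Q mono] that by simp
  then have "pos m l ` {0..<2 * k} = pos m' l' ` {0..<2 * k}" using m 1 2 by metis
  then have "pos m l i = pos m' l' i" if "i < 2 * k" for i
    using strict_mono_on_image_unique[OF mono mono] that by blast
  then show ?thesis using pos_unique[of "2 * k" m l m' l'] k m l by simp
qed

section \<open>Transport and restriction of matchings\<close>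

lemma noncrossing_matching_image:
  assumes P: "noncrossing_matching A P" and f: "strict_mono_on A (f :: 'a::linorder \<Rightarrow> 'b::linorder)"
  shows "noncrossing_matching (f ` A) ((`) f ` P)"
proof -
  have inj: "inj_on f A" using strict_mono_on_imp_inj_on[OF f] .
  have sub: "p \<subseteq> A" if "p \<in> P" for p using that noncrossing_matching_Union[OF P] by blast
  have lt: "x < y" if "f x < f y" "x \<in> A" "y \<in> A" for x y
    using f that by (metis strict_mono_onD linorder_less_linear order_less_asym)
  have "partition_on (f ` A) ((`) f ` P)"
    unfolding partition_on_def
  proof (intro conjI)
    show "\<Union>((`) f ` P) = f ` A" using noncrossing_matching_Union[OF P] by blast
    show "{} \<notin> (`) f ` P" using P by (auto simp: noncrossing_matching_def partition_on_def)
    show "disjoint ((`) f ` P)"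
    proof (rule disjointI)
      fix p q assume "p \<in> (`) f ` P" "q \<in> (`) f ` P" "p \<noteq> q"
      then obtain p' q' where *: "p = f ` p'" "q = f ` q'" "p' \<in> P" "q' \<in> P" "p' \<noteq> q'" by blast
      then have "p' \<inter> q' = {}" using P by (auto simp: noncrossing_matching_def partition_on_def disjoint_def)
      then show "p \<inter> q = {}" using inj_on_image_Int[OF inj sub sub, of p' q'] * by simp
    qed
  qed
  moreover have "\<forall>p\<in>(`) f ` P. card p = 2"
    using P sub card_image[OF inj_on_subset[OF inj]] by (auto simp: noncrossing_matching_def)
  moreover have "\<not> (\<exists>i j k l. i < j \<and> j < k \<and> k < l \<and> {i, k} \<in> (`) f ` P \<and> {j, l} \<in> (`) f ` P)"
  proof
    assume "\<exists>i j k l. i < j \<and> j < k \<and> k < l \<and> {i, k} \<in> (`) f ` P \<and> {j, l} \<in> (`) f ` P"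
    then obtain i j k l p q where *: "i < j" "j < k" "k < l" "{i, k} = f ` p" "{j, l} = f ` q" "p \<in> P" "q \<in> P" by blast
    have "i \<in> f ` p" "k \<in> f ` p" "j \<in> f ` q" "l \<in> f ` q" using *(4,5) by blast+
    then obtain i' k' j' l' where **: "i' \<in> p" "k' \<in> p" "j' \<in> q" "l' \<in> q"
      "i = f i'" "k = f k'" "j = f j'" "l = f l'" by blast
    then have A: "i' \<in> A" "k' \<in> A" "j' \<in> A" "l' \<in> A" using sub * by blast+
    then have "i' < j'" "j' < k'" "k' < l'" using lt * ** by auto
    moreover have "r = {x, y}" if "r \<in> P" "x \<in> r" "y \<in> r" "x \<noteq> y" for r x y
      using that P unfolding noncrossing_matching_def by (auto simp: card_2_iff)
    ultimately have "{i', k'} \<in> P" "{j', l'} \<in> P" using * ** by (metis order_less_irrefl order_less_trans)+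
    with \<open>i' < j'\<close> \<open>j' < k'\<close> \<open>k' < l'\<close> show False using P unfolding noncrossing_matching_def by blast
  qed
  ultimately show ?thesis by (simp add: noncrossing_matching_def)
qed

lemma noncrossing_matching_restrict:
  assumes P: "noncrossing_matching A P" and E: "E \<subseteq> A" "\<And>x y. x \<in> E \<Longrightarrow> {x, y} \<in> P \<Longrightarrow> y \<in> E"
  shows "noncrossing_matching E {p\<in>P. p \<subseteq> E}"
proof -
  have "\<Union>{p\<in>P. p \<subseteq> E} = E"
  proof (intro subset_antisym subsetI)
    fix x assume "x \<in> E"
    moreover obtain y where "{x, y} \<in> P" using noncrossing_matching_partner_exists[OF P] E(1) \<open>x \<in> E\<close> by blast
    ultimately show "x \<in> \<Union>{p\<in>P. p \<subseteq> E}" using E(2) by blast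
  qed blast
  then show ?thesis using P unfolding noncrossing_matching_def partition_on_def disjoint_def by blast
qed


lemma encodes_restrict:
  assumes P: "noncrossing_matching A P" "encodes A w P"
    and E: "E \<subseteq> A" "\<And>x y. x \<in> E \<Longrightarrow> {x, y} \<in> P \<Longrightarrow> y \<in> E"
  shows "encodes E w {p\<in>P. p \<subseteq> E}"
  using P(2) E unfolding encodes_def by blast

lemma encodes_image:
  assumes P: "noncrossing_matching A P" and f: "strict_mono_on A (f :: 'a::linorder \<Rightarrow> 'b::linorder)"
    and enc: "encodes A (\<lambda>i. w (f i)) P"
  shows "encodes (f ` A) w ((`) f ` P)"
  unfolding encodes_def
proof
  fix x assume "x \<in> f ` A"
  then obtain a where a: "a \<in> A" "x = f a" by blast
  have inj: "inj_on f A" using strict_mono_on_imp_inj_on[OF f] .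
  have "w x = L \<longleftrightarrow> (\<exists>b. a < b \<and> {a, b} \<in> P)" using enc a by (auto simp: encodes_def)
  also have "\<dots> \<longleftrightarrow> (\<exists>y. x < y \<and> {x, y} \<in> (`) f ` P)"
  proof
    assume "\<exists>b. a < b \<and> {a, b} \<in> P"
    then obtain b where b: "a < b" "{a, b} \<in> P" by blast
    then have "f a < f b" using noncrossing_matching_pairD[OF P b(2)] f by (auto simp: strict_mono_on_def)
    moreover have "{f a, f b} \<in> (`) f ` P" using b(2) by (intro image_eqI[of _ _ "{a, b}"]) auto
    ultimately show "\<exists>y. x < y \<and> {x, y} \<in> (`) f ` P" using a by blast
  next
    assume "\<exists>y. x < y \<and> {x, y} \<in> (`) f ` P"
    then obtain y p where y: "x < y" "p \<in> P" "{x, y} = f ` p" by blast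
    obtain b c where p: "p = {b, c}" using P y(2) by (auto simp: noncrossing_matching_def card_2_iff)
    have bc: "b \<in> A" "c \<in> A" using noncrossing_matching_pairD[OF P] y(2) p by auto
    have "(f a = f b \<and> y = f c) \<or> (f a = f c \<and> y = f b)" using y(3) p a by (auto simp: doubleton_eq_iff)
    then have "\<exists>d\<in>A. p = {a, d} \<and> y = f d"
      using inj_onD[OF inj] a bc p by (metis insert_commute)
    then obtain d where d: "d \<in> A" "p = {a, d}" "y = f d" by blast
    then have "\<not> d \<le> a" using y(1) a f strict_mono_on_leD[OF f] by (metis leD)
    then show "\<exists>b. a < b \<and> {a, b} \<in> P" using d y(2) by (auto simp: not_le)
  qed
  finally show "w x = L \<longleftrightarrow> (\<exists>y. x < y \<and> {x, y} \<in> (`) f ` P)" .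
qed

text \<open>Ensures that \<open>card E div 2\<close> in the definition of the shape loses
  nothing.\<close>

lemma even_card_closed:
  assumes P: "noncrossing_matching A P" and E: "finite E" "E \<subseteq> A" "\<And>x y. x \<in> E \<Longrightarrow> {x, y} \<in> P \<Longrightarrow> y \<in> E"
  shows "even (card E)"
proof -
  define w where "w i = (if \<exists>j. i < j \<and> {i, j} \<in> P then L else R)" for i
  have "encodes A w P" by (auto simp: encodes_def w_def)
  then have "(\<Sum>x\<in>E. step (w x)) = 0"
    using E(2,3) partner_props[OF P] by (intro sum_step_closed[OF P]) blast+
  then show ?thesis using even_card_if_sum_step_eq_0[OF E(1)] by blast
qed

text \<open>Given the shape, \<open>f\<close> is the inverse of the bijection \<open>g\<close>, and
  parity puts it in the form \<open>pos m l\<close>. Conversely the linking condition maps the pairs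
  of \<open>C\<close> to pairs of the noodle, so the image of \<open>pos m l\<close> is the
  component of 0 with the right words.\<close>

lemma noodle_shape_iff:
  assumes k: "k \<ge> 1" and C: "meander k C"
  shows "noodle_shape wa wb C \<longleftrightarrow> matched_word wa \<and> matched_word wb \<and>
    (\<exists>m<2 * k. \<exists>l\<in>{0..2 * k - 2} \<rightarrow>\<^sub>E UNIV. linked wa (pos m l) (fst C) \<and> linked wb (pos m l) (snd C))"
proof
  have nc: "noncrossing_matching {0..<2 * k} (fst C)" "noncrossing_matching {0..<2 * k} (snd C)"
    and ms: "meandric_system k C"
    using C by (auto simp: meander_def meandric_system_def)
  {
    assume "noodle_shape wa wb C"
    then obtain P Q E g where P: "noncrossing_matching UNIV P" "encodes UNIV wa P"
      and Q: "noncrossing_matching UNIV Q" "encodes UNIV wb Q"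
      and E: "E = graph_component P Q 0" "finite E" and g: "bij_betw g E {0..<card E}" "strict_mono_on E g"
      and ms': "meandric_system (card E div 2) C"
      and enc: "encodes {0..<card E} (\<lambda>i. wa (inv_into E g i)) (fst C)" "encodes {0..<card E} (\<lambda>i. wb (inv_into E g i)) (snd C)"
      unfolding noodle_shape_def by blast
    have cl: "y \<in> E" if "x \<in> E" "adjacent P Q x y" for x y
      using that unfolding E(1) graph_component_def mem_Collect_eq by (rule rtranclp.rtrancl_into_rtrancl)
    have clP: "y \<in> E" if "x \<in> E" "{x, y} \<in> P" for x y
      using that cl[of x y] by (simp add: adjacent_def)
    have clQ: "y \<in> E" if "x \<in> E" "{x, y} \<in> Q" for x y
      using that cl[of x y] by (simp add: adjacent_def)
    \<comment> \<open>\<open>C\<close> is a system on \<open>2 * k\<close> points and on the points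
      of \<open>E\<close>; its ground set, the union of its pairs, forces the sizes to
      agree.\<close>
    have "{0..<2 * (card E div 2)} = {0..<2 * k}"
      using ms' nc(1) noncrossing_matching_Union unfolding meandric_system_def by metis
    then have "card {0..<2 * (card E div 2)} = card {0..<2 * k}" by (rule arg_cong)
    moreover have "even (card E)" using even_card_closed[OF P(1) E(2) _ clP] by simp
    ultimately have card: "card E = 2 * k" by simp
    define f where "f = inv_into E g"
    have fg: "f (g x) = x" if "x \<in> E" for x
      using that g(1) by (simp add: f_def bij_betw_inv_into_left)
    have gf: "g (f i) = i" "f i \<in> E" if "i < 2 * k" for i
      using that g(1) card by (auto simp: f_def bij_betw_inv_into_right bij_betw_def inv_into_into)
    have f: "strict_mono_on {0..<2 * k} f"
    proof (rule strict_mono_onI)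
      fix i j assume "i \<in> {0..<2 * k}" "j \<in> {0..<2 * k}" "i < j"
      then have "g (f i) < g (f j)" "f i \<in> E" "f j \<in> E" using gf by auto
      then show "f i < f j" using g(2) strict_mono_on_leD[OF g(2), of "f j" "f i"] by (meson leD not_le)
    qed
    have img: "f ` {0..<2 * k} = E"
      using bij_betw_inv_into[OF g(1)] card by (simp add: f_def bij_betw_def)
    have link: "linked w f P'"
      if R: "noncrossing_matching UNIV R" "encodes UNIV w R" and cl: "\<And>x y. x \<in> E \<Longrightarrow> {x, y} \<in> R \<Longrightarrow> y \<in> E"
        and P': "noncrossing_matching {0..<2 * k} P'" and encP': "encodes {0..<2 * k} (\<lambda>i. w (f i)) P'" for w R P'
    proof -
      \<comment> \<open>The image of \<open>P'\<close> and the restriction of \<open>R\<close> to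
        the component have the same word on \<open>E\<close>, and a word determines its
        matching.\<close>
      have "(`) f ` P' = {p\<in>R. p \<subseteq> E}"
      proof (rule matching_unique)
        show "noncrossing_matching E ((`) f ` P')" using noncrossing_matching_image[OF P' f] by (simp only: img)
        show "encodes E w ((`) f ` P')" using encodes_image[OF P' f encP'] by (simp only: img)
        show "noncrossing_matching E {p\<in>R. p \<subseteq> E}" by (rule noncrossing_matching_restrict[OF R(1) subset_UNIV]) (fact cl)
        show "encodes E w {p\<in>R. p \<subseteq> E}" by (rule encodes_restrict[OF R subset_UNIV]) (fact cl)
        show "finite (E \<inter> {i..j})" for i j using E(2) by simp
      qed
      then have "{f x, f y} \<in> R" if "{x, y} \<in> P'" for x y
        using imageI[OF that, of "(`) f"] by auto
      then show ?thesis using linked_iff_subset[OF P' R f] by simp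
    qed
    have l1: "linked wa f (fst C)" using link[OF P clP nc(1)] enc(1) card by (simp add: f_def)
    have l2: "linked wb f (snd C)" using link[OF Q clQ nc(2)] enc(2) card by (simp add: f_def)
    have "0 \<in> E" by (simp add: E(1) graph_component_def)
    then obtain m where m: "m < 2 * k" "f m = 0" using img by (metis imageE atLeastLessThan_iff)
    have odd: "odd (f b - f a)" if ab: "(a, b) \<in> arcs (fst C) \<union> arcs (snd C)" for a b
    proof -
      have "a < 2 * k" "b < 2 * k" "a < b" using ab arcs_subset[OF nc(1)] arcs_subset[OF nc(2)] by (auto simp: arcs_def)
      then have "f a < f b" using f by (auto simp: strict_mono_on_def)
      then show ?thesis using ab l1 l2 odd_excursion_length unfolding linked_def by blast
    qed
    \<comment> \<open>Neighbouring points need not be joined by an arc; their odd distance comes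
      from the constant parity of \<open>f i - i\<close> on the connected meander.\<close>
    have "odd (f (Suc i) - f i)" if "Suc i < 2 * k" for i
      using even_gaps[OF C, of f i "Suc i"] odd that by simp
    moreover have "f i < f (Suc i)" if "Suc i < 2 * k" for i
      using f that by (auto simp: strict_mono_on_def)
    ultimately obtain l where l: "l \<in> {0..2 * k - 2} \<rightarrow>\<^sub>E UNIV" "\<And>i. i < 2 * k \<Longrightarrow> f i = pos m l i"
      using ex_pos_if_odd_gaps[of "2 * k" f m] m by blast
    have "linked w (pos m l) P'" if "linked w f P'" "noncrossing_matching {0..<2 * k} P'" for w P'
    proof -
      have "excursion w {pos m l a..pos m l b}" if ab: "(a, b) \<in> arcs P'" for a b
      proof -
        have "a < 2 * k" "b < 2 * k" using ab arcs_subset[OF \<open>noncrossing_matching {0..<2 * k} P'\<close>] by auto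
        moreover have "excursion w {f a..f b}" using \<open>linked w f P'\<close> ab unfolding linked_def by blast
        ultimately show ?thesis using l(2) by simp
      qed
      then show ?thesis unfolding linked_def by blast
    qed
    with l1 l2 nc have "linked wa (pos m l) (fst C)" "linked wb (pos m l) (snd C)" by blast+
    then show "matched_word wa \<and> matched_word wb \<and>
      (\<exists>m<2 * k. \<exists>l\<in>{0..2 * k - 2} \<rightarrow>\<^sub>E UNIV. linked wa (pos m l) (fst C) \<and> linked wb (pos m l) (snd C))"
      using P Q l(1) m(1) unfolding matched_word_iff by blast
  next
    assume "matched_word wa \<and> matched_word wb \<and>
      (\<exists>m<2 * k. \<exists>l\<in>{0..2 * k - 2} \<rightarrow>\<^sub>E UNIV. linked wa (pos m l) (fst C) \<and> linked wb (pos m l) (snd C))"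
    then obtain P Q m l where P: "noncrossing_matching UNIV P" "encodes UNIV wa P"
      and Q: "noncrossing_matching UNIV Q" "encodes UNIV wb Q" and m: "m < 2 * k"
      and l: "linked wa (pos m l) (fst C)" "linked wb (pos m l) (snd C)"
      unfolding matched_word_iff by blast
    define f where "f = pos m l"
    have sm: "strict_mono f" unfolding f_def by (rule strict_mono_pos)
    then have f: "strict_mono_on A f" for A by (intro strict_mono_onI) (rule strict_monoD)
    have inj: "inj f" using sm by (rule strict_mono_imp_inj_on)
    have fP: "{f x, f y} \<in> P" if "{x, y} \<in> fst C" for x y
      using linked_iff_subset[OF nc(1) P f] l(1) that by (simp add: f_def)
    have fQ: "{f x, f y} \<in> Q" if "{x, y} \<in> snd C" for x y
      using linked_iff_subset[OF nc(2) Q f] l(2) that by (simp add: f_def)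
    define E where "E = graph_component P Q 0"
    have "graph_component P Q (f m) = f ` {0..<2 * k}"
      by (rule graph_component_image[OF C P(1) Q(1) _ _ m]) (fact fP fQ)+
    then have E: "E = f ` {0..<2 * k}" by (simp add: E_def f_def)
    have card: "card E = 2 * k" using card_image[OF inj_on_subset[OF inj]] by (simp add: E)
    define g where "g = inv f"
    have gf: "g (f i) = i" for i using inj by (simp add: g_def)
    have g: "bij_betw g E {0..<card E}"
      unfolding card by (intro bij_betw_byWitness[of _ f]) (auto simp: E gf)
    have gm: "strict_mono_on E g"
      by (rule strict_mono_onI) (auto simp: E gf strict_mono_less[OF sm])
    have inv: "inv_into E g i = f i" if "i < 2 * k" for i
      using that by (intro inv_into_f_eq bij_betw_imp_inj_on[OF g]) (auto simp: E gf)
    have enc: "encodes {0..<card E} (\<lambda>i. w (inv_into E g i)) P'"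
      if R: "noncrossing_matching UNIV R" "encodes UNIV w R" and P': "noncrossing_matching {0..<2 * k} P'"
        and sub: "\<And>x y. {x, y} \<in> P' \<Longrightarrow> {f x, f y} \<in> R" for w R P'
      unfolding encodes_def card
    proof
      fix i assume i: "i \<in> {0..<2 * k}"
      then obtain j where j: "{i, j} \<in> P'" using noncrossing_matching_partner_exists[OF P'] by blast
      have "w (f i) = L \<longleftrightarrow> f i < f j"
        using encodes_L_iff[OF R] partner_eqI[OF R(1) sub[OF j]] by simp
      also have "\<dots> \<longleftrightarrow> i < j" by (rule strict_mono_less[OF sm])
      also have "\<dots> \<longleftrightarrow> (\<exists>j. i < j \<and> {i, j} \<in> P')"
        using j noncrossing_matching_partner_unique[OF P' j] by blast
      finally show "w (inv_into E g i) = L \<longleftrightarrow> (\<exists>j. i < j \<and> {i, j} \<in> P')" using inv i by simp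
    qed
    show "noodle_shape wa wb C"
      unfolding noodle_shape_def
    proof (intro exI conjI)
      show "meandric_system (card E div 2) C" using ms card by simp
      show "encodes {0..<card E} (\<lambda>i. wa (inv_into E g i)) (fst C)" by (rule enc[OF P nc(1) fP])
      show "encodes {0..<card E} (\<lambda>i. wb (inv_into E g i)) (snd C)" by (rule enc[OF Q nc(2) fQ])
    qed (fact P Q E_def g gm | simp add: E)+
  }
qed

section \<open>Factorisation over the faces\<close>

text \<open>The integers that belong to the face of \<open>p\<close>. Ends of nested arcs are left
  out even though they touch this face: they are counted with their own arcs, which makes these sets
  disjoint.\<close>

definition arc_points :: "(nat \<Rightarrow> int) \<Rightarrow> (nat \<times> nat) set \<Rightarrow> nat \<times> nat \<Rightarrow> int set" where
  "arc_points f U p = {f (fst p), f (snd p)} \<union> (\<Union>i\<in>visible U p. {f i<..<f (Suc i)})"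

lemma laminar_endpoints:
  assumes "laminar U" "(a, b) \<in> U" "(c, d) \<in> U" "{a, b} \<inter> {c, d} \<noteq> {}"
  shows "(a, b) = (c, d)"
  using laminar_cases[OF assms(1-3)] laminarD[OF assms(1,2)] laminarD[OF assms(1,3)] assms(4) by auto

lemma visible_disjoint:
  assumes "laminar U" "p \<in> U" "q \<in> U" "i \<in> visible U p" "i \<in> visible U q"
  shows "p = q"
proof -
  obtain a b c d where pq: "p = (a, b)" "q = (c, d)" by (metis surj_pair)
  show ?thesis
    using laminar_cases[OF assms(1), of a b c d] assms(2-) unfolding pq by (fastforce simp: visible_def)
qed

locale gap_map =
  fixes n :: nat and P :: "nat set set" and f :: "nat \<Rightarrow> int"
  assumes P: "noncrossing_matching {0..<n} P" and f: "strict_mono f"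
begin

abbreviation "U \<equiv> arcs P"

lemmas lam = laminar_arcs[OF P]

lemma f_less: "f i < f j \<longleftrightarrow> i < j" and f_le: "f i \<le> f j \<longleftrightarrow> i \<le> j" and f_eq: "f i = f j \<longleftrightarrow> i = j"
  using strict_mono_less[OF f] strict_mono_less_eq[OF f] strict_mono_eq[OF f] by auto

lemma finite_U: "finite U"
  using arcs_subset[OF P] by (rule finite_subset) simp

lemma gap_index: "f i < x \<Longrightarrow> x < f (Suc i) \<Longrightarrow> f j < x \<Longrightarrow> x < f (Suc j) \<Longrightarrow> i = j"
proof -
  assume "f i < x" "x < f (Suc i)" "f j < x" "x < f (Suc j)"
  then have "f i < f (Suc j)" "f j < f (Suc i)" by linarith+
  then show ?thesis by (simp add: f_less)
qed

lemma not_in_gap: "f i < f j \<Longrightarrow> f j < f (Suc i) \<Longrightarrow> False"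
  by (simp add: f_less)

text \<open>Distinct arcs share no endpoint, a gap is visible from only one arc, and no endpoint
  lies in a gap. Independence of the faces rests on this.\<close>

lemma arc_points_disjoint:
  assumes "p \<in> U" "q \<in> U" "p \<noteq> q"
  shows "arc_points f U p \<inter> arc_points f U q = {}"
proof (rule ccontr)
  obtain a b c d where pq: "p = (a, b)" "q = (c, d)" by (metis surj_pair)
  assume "arc_points f U p \<inter> arc_points f U q \<noteq> {}"
  then obtain x where x: "x \<in> arc_points f U p" "x \<in> arc_points f U q" by blast
  have "{a, b} \<inter> {c, d} = {}" using laminar_endpoints[OF lam] assms pq by blast
  moreover have "visible U p \<inter> visible U q = {}" using visible_disjoint[OF lam assms(1,2)] assms(3) by blast
  ultimately show False
    using x unfolding arc_points_def pq fst_conv snd_conv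
    by (auto simp: f_eq dest: gap_index not_in_gap)
qed

lemma arc_points_subset: "(a, b) \<in> U \<Longrightarrow> arc_points f U (a, b) \<subseteq> {f a..f b}"
proof -
  assume "(a, b) \<in> U"
  then have "a < b" by (rule laminarD[OF lam])
  then have "f a < f b" by (simp add: f_less)
  moreover have "f a \<le> x \<and> x \<le> f b" if "i \<in> visible U (a, b)" "f i < x" "x < f (Suc i)" for i x
  proof -
    have "f a \<le> f i" "f (Suc i) \<le> f b" using that by (auto simp: visible_def f_le)
    then show ?thesis using that by linarith
  qed
  ultimately show ?thesis by (auto simp: arc_points_def)
qed

lemma finite_arc_points: "p \<in> U \<Longrightarrow> finite (arc_points f U p)"
  using finite_subset[OF arc_points_subset] by (cases p) auto

lemma point_cases:
  assumes "f a \<le> x" "x \<le> f b"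
  obtains i where "a \<le> i" "i \<le> b" "x = f i" | i where "a \<le> i" "i < b" "f i < x" "x < f (Suc i)"
proof -
  define i where "i = (GREATEST i. f i \<le> x)"
  have bd: "\<forall>i. f i \<le> x \<longrightarrow> i \<le> b" using assms(2) f_le by (meson order_trans)
  have i: "f i \<le> x" unfolding i_def using GreatestI_nat[of "\<lambda>i. f i \<le> x"] assms(1) bd by blast
  have max: "j \<le> i" if "f j \<le> x" for j
    unfolding i_def using Greatest_le_nat[of "\<lambda>i. f i \<le> x", OF that] bd by blast
  have "a \<le> i" using max assms(1) by blast
  moreover have "x < f (Suc i)" using max[of "Suc i"] by fastforce
  moreover have "i \<le> b" using bd i by blast
  moreover have "i < b" if "f i < x"
  proof -
    have "f i < f b" using that assms(2) by linarith
    then show ?thesis by (simp add: f_less)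
  qed
  ultimately show ?thesis using i that by (cases "f i = x") auto
qed

text \<open>A point of the embedding belongs to the arc that joins it to its partner, a point in a
  gap to the shortest arc above that gap.\<close>

lemma arc_points_cover:
  assumes ab: "(a, b) \<in> U" and x: "f a \<le> x" "x \<le> f b"
  obtains c d where "(c, d) \<in> U" "a \<le> c" "d \<le> b" "x \<in> arc_points f U (c, d)"
  using x
proof (cases rule: point_cases)
  case (1 i)
  have ab': "{a, b} \<in> P" "a < b" using ab by (auto simp: arcs_def)
  have i: "i \<in> {0..<n}" using 1 noncrossing_matching_pairD(2)[OF P ab'(1)] by auto
  define j where "j = partner P i"
  have j: "{i, j} \<in> P" "j \<noteq> i" using partner_props[OF P i] by (auto simp: j_def)
  have "a \<le> j \<and> j \<le> b" using noncrossing_interval_closed[OF P ab' i] 1 by (simp add: j_def)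
  moreover have "(i, j) \<in> U \<or> (j, i) \<in> U" using j by (auto simp: arcs_def insert_commute)
  ultimately show ?thesis using that[of i j] that[of j i] 1 by (auto simp: arc_points_def)
next
  case (2 i)
  define V where "V = {(c, d) \<in> U. a \<le> c \<and> d \<le> b \<and> c \<le> i \<and> i < d}"
  have "\<exists>p. p \<in> V" using ab 2 by (auto simp: V_def)
  then obtain p where p: "p \<in> V" "\<And>q. q \<in> V \<Longrightarrow> snd p - fst p \<le> snd q - fst q"
    using ex_has_least_nat[of "\<lambda>p. p \<in> V" _ "\<lambda>p. snd p - fst p"] by blast
  obtain c d where cd: "p = (c, d)" by fastforce
  have V: "(c, d) \<in> U" "a \<le> c" "d \<le> b" "c \<le> i" "i < d" using p(1) by (auto simp: V_def cd)
  have "\<not> (c' \<le> i \<and> i < d')" if "(c', d') \<in> U" "c < c'" "d' < d" for c' d'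
  proof
    assume "c' \<le> i \<and> i < d'"
    then have "(c', d') \<in> V" using that V by (auto simp: V_def)
    from p(2)[OF this] have "d - c \<le> d' - c'" by (simp add: cd)
    then show False using that(2,3) \<open>c' \<le> i \<and> i < d'\<close> by arith
  qed
  then have "i \<in> visible U (c, d)" using V by (auto simp: visible_def)
  then have "x \<in> arc_points f U (c, d)" using 2 by (auto simp: arc_points_def)
  then show ?thesis using that V by blast
qed

lemma nested_strict:
  assumes "(a, b) \<in> U" "(c, d) \<in> U" "(c, d) \<noteq> (a, b)" "a \<le> c" "d \<le> b"
  shows "a < c" "d < b"
  using laminar_cases[OF lam assms(1,2)] assms laminarD[OF lam assms(1)] laminarD[OF lam assms(2)] by auto

lemma arc_points_nested_disjoint:
  assumes "(a, b) \<in> U" "(c, d) \<in> U" "a < c" "d < b" "x \<in> arc_points f U (a, b)"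
  shows "\<not> (f c \<le> x \<and> x \<le> f d)"
proof
  assume "f c \<le> x \<and> x \<le> f d"
  then obtain c' d' where *: "(c', d') \<in> U" "c \<le> c'" "d' \<le> d" "x \<in> arc_points f U (c', d')"
    using arc_points_cover[OF assms(2)] by metis
  then have "(c', d') \<noteq> (a, b)" using assms(3) by auto
  then show False using arc_points_disjoint[OF *(1) assms(1)] * assms(5) by blast
qed

text \<open>Since \<open>t\<close> is on the face of the arc itself, no nested arc spans it: every
  nested arc is passed completely before \<open>t\<close> or starts after it.\<close>

lemma initial_segment_eq:
  assumes ab: "(a, b) \<in> U" and t: "t \<in> arc_points f U (a, b)"
  shows "{f a..t} = {x \<in> arc_points f U (a, b). x \<le> t} \<union>
     (\<Union>p\<in>{(c, d) \<in> U. a < c \<and> d < b \<and> f d < t}. arc_points f U p)" (is "?L = ?R")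
proof
  have tab: "f a \<le> t" "t \<le> f b" using arc_points_subset[OF ab] t by auto
  show "?L \<subseteq> ?R"
  proof
    fix x assume x: "x \<in> {f a..t}"
    then obtain c d where cd: "(c, d) \<in> U" "a \<le> c" "d \<le> b" "x \<in> arc_points f U (c, d)"
      using arc_points_cover[OF ab, of x] tab by auto
    show "x \<in> ?R"
    proof (cases "(c, d) = (a, b)")
      case True
      then show ?thesis using cd x by auto
    next
      case False
      then have s: "a < c" "d < b" using nested_strict[OF ab cd(1) _ cd(2,3)] by auto
      have "f c \<le> x" using arc_points_subset[OF cd(1)] cd(4) by auto
      then have "f d < t" using arc_points_nested_disjoint[OF ab cd(1) s t] x by auto
      then show ?thesis using cd s by blast
    qed
  qed
  show "?R \<subseteq> ?L"
  proof
    fix x assume "x \<in> ?R"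
    then show "x \<in> ?L"
    proof
      assume "x \<in> {x \<in> arc_points f U (a, b). x \<le> t}"
      then show ?thesis using arc_points_subset[OF ab] by auto
    next
      assume "x \<in> (\<Union>p\<in>{(c, d) \<in> U. a < c \<and> d < b \<and> f d < t}. arc_points f U p)"
      then obtain c d where cd: "(c, d) \<in> U" "a < c" "d < b" "f d < t" "x \<in> arc_points f U (c, d)" by blast
      have "f a < f c" using cd(2) by (simp add: f_less)
      then show ?thesis using arc_points_subset[OF cd(1)] cd by auto
    qed
  qed
qed

text \<open>Completely passed nested faces contribute 0, so at the points of a face the walk over
  the interval and the walk along the face have equal heights.\<close>

lemma sum_initial_segment:
  fixes g :: "int \<Rightarrow> int"
  assumes ab: "(a, b) \<in> U" and t: "t \<in> arc_points f U (a, b)"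
    and z: "\<And>c d. (c, d) \<in> U \<Longrightarrow> a < c \<Longrightarrow> d < b \<Longrightarrow> (\<Sum>x\<in>arc_points f U (c, d). g x) = 0"
  shows "(\<Sum>x\<in>{f a..t}. g x) = (\<Sum>x\<in>{x \<in> arc_points f U (a, b). x \<le> t}. g x)"
proof -
  define N where "N = {(c, d) \<in> U. a < c \<and> d < b \<and> f d < t}"
  have "N \<subseteq> U" by (auto simp: N_def)
  then have N: "finite N" "N \<subseteq> U" using finite_subset[OF _ finite_U] by auto
  have "(\<Sum>x\<in>(\<Union>p\<in>N. arc_points f U p). g x) = (\<Sum>p\<in>N. \<Sum>x\<in>arc_points f U p. g x)"
    using N arc_points_disjoint finite_arc_points by (intro sum.UNION_disjoint) blast+
  also have "\<dots> = 0" using z by (intro sum.neutral) (auto simp: N_def)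
  finally have 0: "(\<Sum>x\<in>(\<Union>p\<in>N. arc_points f U p). g x) = 0" .
  have "(a, b) \<notin> N" by (auto simp: N_def)
  then have "{x \<in> arc_points f U (a, b). x \<le> t} \<inter> (\<Union>p\<in>N. arc_points f U p) = {}"
    using arc_points_disjoint[OF ab] N by blast
  moreover have "finite {x \<in> arc_points f U (a, b). x \<le> t}" using finite_arc_points[OF ab] by simp
  moreover have "finite (\<Union>p\<in>N. arc_points f U p)" using N finite_arc_points by blast
  ultimately show ?thesis
    unfolding initial_segment_eq[OF ab t] N_def[symmetric] using 0 by (simp add: sum.union_disjoint)
qed

lemma arc_points_last: "f b \<in> arc_points f U (a, b)" and arc_points_first: "f a \<in> arc_points f U (a, b)"
  by (auto simp: arc_points_def)

lemma arc_points_le_last: "(a, b) \<in> U \<Longrightarrow> {x \<in> arc_points f U (a, b). x \<le> f b} = arc_points f U (a, b)"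
  using arc_points_subset[of a b] by auto

lemma excursion_arc_points:
  assumes ab: "(a, b) \<in> U" and exc: "excursion w {f a..f b}"
    and z: "\<And>c d. (c, d) \<in> U \<Longrightarrow> a < c \<Longrightarrow> d < b \<Longrightarrow> (\<Sum>x\<in>arc_points f U (c, d). step (w x)) = 0"
  shows "excursion w (arc_points f U (a, b))"
  unfolding excursion_def passage_def
proof (intro conjI ballI impI)
  note seg = sum_initial_segment[OF ab, of _ "\<lambda>x. step (w x)", OF _ z]
  show "arc_points f U (a, b) \<noteq> {}" using arc_points_first by blast
  show "0 + (\<Sum>x\<in>arc_points f U (a, b). step (w x)) = 0"
    using seg[OF arc_points_last] excursion_sum_eq_0[OF exc] arc_points_le_last[OF ab] by simp
  fix t assume t: "t \<in> arc_points f U (a, b)" "\<exists>u\<in>arc_points f U (a, b). t < u"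
  then have "f a \<le> t" "t < f b" using arc_points_subset[OF ab] by force+
  then have "0 < (\<Sum>x\<in>{x\<in>{f a..f b}. x \<le> t}. step (w x))"
    by (intro excursion_sum_pos[OF exc, of t "f b"]) auto
  moreover have "{x\<in>{f a..f b}. x \<le> t} = {f a..t}" using \<open>t < f b\<close> by auto
  ultimately show "0 < 0 + (\<Sum>x\<in>{x \<in> arc_points f U (a, b). x \<le> t}. step (w x))"
    using seg[OF t(1)] by simp
qed

text \<open>At points of the face the height is that of the face's own walk. Any other point lies
  under a nested arc, whose excursion starts from a height that is already known to be positive, by
  induction from the left.\<close>

lemma excursion_interval:
  assumes ab: "(a, b) \<in> U" and exc: "excursion w (arc_points f U (a, b))"
    and z: "\<And>c d. (c, d) \<in> U \<Longrightarrow> a < c \<Longrightarrow> d < b \<Longrightarrow> (\<Sum>x\<in>arc_points f U (c, d). step (w x)) = 0"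
    and nest: "\<And>c d. (c, d) \<in> U \<Longrightarrow> a < c \<Longrightarrow> d < b \<Longrightarrow> excursion w {f c..f d}"
  shows "excursion w {f a..f b}"
proof -
  note seg = sum_initial_segment[OF ab, of _ "\<lambda>x. step (w x)", OF _ z]
  have fab: "f a < f b" using laminarD[OF lam ab] by (simp add: f_less)
  have pos: "0 < (\<Sum>x\<in>{f a..t}. step (w x))" if "f a \<le> t" "t < f b" for t
    using that
  proof (induction "nat (t - f a)" arbitrary: t rule: less_induct)
    case less
    obtain c d where cd: "(c, d) \<in> U" "a \<le> c" "d \<le> b" "t \<in> arc_points f U (c, d)"
      using arc_points_cover[OF ab, of t] less.prems by auto
    show ?case
    proof (cases "(c, d) = (a, b)")
      case True
      then have t: "t \<in> arc_points f U (a, b)" using cd by simp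
      have "0 < (\<Sum>x\<in>{x \<in> arc_points f U (a, b). x \<le> t}. step (w x))"
        using excursion_sum_pos[OF exc t arc_points_last] less.prems by simp
      then show ?thesis using seg[OF t] by simp
    next
      case False
      then have s: "a < c" "d < b" using nested_strict[OF ab cd(1) _ cd(2,3)] by auto
      have t: "f c \<le> t" "t \<le> f d" using arc_points_subset[OF cd(1)] cd(4) by auto
      have fac: "f a < f c" using s by (simp add: f_less)
      have e: "excursion w {f c..f d}" using nest[OF cd(1) s] .
      \<comment> \<open>Only weak positivity holds here: the sum is 0 when \<open>t\<close> is the
        right end of the nested arc.\<close>
      have "0 \<le> (\<Sum>x\<in>{f c..t}. step (w x))"
      proof (cases "t = f d")
        case True
        then show ?thesis using excursion_sum_eq_0[OF e] by simp
      next
        case False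
        then have "{x\<in>{f c..f d}. x \<le> t} = {f c..t}" using t by auto
        then show ?thesis using excursion_sum_pos[OF e, of t "f d"] t False by simp
      qed
      \<comment> \<open>The position just before the nested arc is still at least
        \<open>f a\<close>, so the induction hypothesis applies.\<close>
      moreover have "0 < (\<Sum>x\<in>{f a..f c - 1}. step (w x))"
        using less.hyps[of "f c - 1"] fac t less.prems by simp
      moreover have "{f a..t} = {f a..f c - 1} \<union> {f c..t}" using fac t by auto
      ultimately show ?thesis by (simp add: sum.union_disjoint)
    qed
  qed
  show ?thesis
    unfolding excursion_def passage_def
  proof (intro conjI ballI impI)
    show "{f a..f b} \<noteq> {}" using fab by simp
    show "0 + (\<Sum>x\<in>{f a..f b}. step (w x)) = 0"
      using seg[OF arc_points_last] excursion_sum_eq_0[OF exc] arc_points_le_last[OF ab] by simp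
    fix t assume t: "t \<in> {f a..f b}" "\<exists>u\<in>{f a..f b}. t < u"
    then have "{x\<in>{f a..f b}. x \<le> t} = {f a..t}" by auto
    then show "0 < 0 + (\<Sum>x\<in>{x \<in> {f a..f b}. x \<le> t}. step (w x))" using pos[of t] t by auto
  qed
qed

text \<open>Induction on the length of the arc. From left to right it supplies the vanishing sums of
  the nested faces; from right to left these sums are given, and it supplies the nested interval
  excursions.\<close>

lemma excursions_iff:
  "(\<forall>(a, b)\<in>U. excursion w {f a..f b}) \<longleftrightarrow> (\<forall>p\<in>U. excursion w (arc_points f U p))"
proof
  assume l: "\<forall>(a, b)\<in>U. excursion w {f a..f b}"
  have "excursion w (arc_points f U (a, b))" if "(a, b) \<in> U" for a b
    using that
  proof (induction "b - a" arbitrary: a b rule: less_induct)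
    case less
    show ?case
    proof (rule excursion_arc_points[OF less.prems])
      show "excursion w {f a..f b}" using l less.prems by blast
      fix c d assume cd: "(c, d) \<in> U" "a < c" "d < b"
      then have "d - c < b - a" using laminarD[OF lam cd(1)] by simp
      then show "(\<Sum>x\<in>arc_points f U (c, d). step (w x)) = 0"
        using excursion_sum_eq_0 less.hyps cd(1) by blast
    qed
  qed
  then show "\<forall>p\<in>U. excursion w (arc_points f U p)" by fast
next
  assume r: "\<forall>p\<in>U. excursion w (arc_points f U p)"
  have "excursion w {f a..f b}" if "(a, b) \<in> U" for a b
    using that
  proof (induction "b - a" arbitrary: a b rule: less_induct)
    case less
    show ?case
    proof (rule excursion_interval[OF less.prems])
      show "excursion w (arc_points f U (a, b))" using r less.prems by blast
      fix c d assume cd: "(c, d) \<in> U" "a < c" "d < b"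
      then have "d - c < b - a" using laminarD[OF lam cd(1)] by simp
      then show "excursion w {f c..f d}" using less.hyps cd(1) by blast
      show "(\<Sum>x\<in>arc_points f U (c, d). step (w x)) = 0"
        using excursion_sum_eq_0 r cd(1) by blast
    qed
  qed
  then show "\<forall>(a, b)\<in>U. excursion w {f a..f b}" by fast
qed

lemma card_arc_points:
  assumes gap: "\<And>i. f (Suc i) = f i + 2 * int (l i) + 1" and p: "p \<in> U"
  shows "card (arc_points f U p) = 2 * (\<Sum>i\<in>visible U p. l i) + 2"
proof -
  obtain a b where ab: "p = (a, b)" by fastforce
  have lt: "a < b" using laminarD[OF lam] p ab by blast
  define G where "G = (\<Union>i\<in>visible U p. {f i<..<f (Suc i)})"
  have fin: "finite (visible U p)" by (rule finite_subset[of _ "{a..<b}"]) (auto simp: visible_def ab)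
  have c: "card {f i<..<f (Suc i)} = 2 * l i" for i using gap[of i] by simp
  have "card G = (\<Sum>i\<in>visible U p. card {f i<..<f (Suc i)})"
    unfolding G_def using fin gap_index by (intro card_UN_disjoint) auto
  then have "card G = 2 * (\<Sum>i\<in>visible U p. l i)" by (simp only: c sum_distrib_left)
  moreover have "f a \<notin> G" "f b \<notin> G" using not_in_gap by (auto simp: G_def)
  moreover have "f a \<noteq> f b" using lt by (simp add: f_eq)
  moreover have "finite G" using fin by (simp add: G_def)
  moreover have "arc_points f U p = insert (f a) (insert (f b) G)" by (auto simp: arc_points_def G_def ab)
  ultimately show ?thesis by simp
qed

end

section \<open>Probabilities\<close>

lemma arc_weight_eq: "arc_weight n = catalan n / 4 ^ n"
proof -
  have "- 2 * int n = - int (2 * n)" by simp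
  then have "(2::real) powi (- 2 * int n) = inverse (2 ^ (2 * n))"
    by (simp only: power_int_minus power_int_of_nat)
  then show ?thesis by (simp add: arc_weight_def power_mult divide_inverse)
qed

text \<open>Writes the condition as a finite union of cylinders.\<close>

lemma excursion_iff_ex_word:
  "excursion w S \<longleftrightarrow> (\<exists>v\<in>{v \<in> S \<rightarrow>\<^sub>E UNIV. excursion v S}. \<forall>x\<in>S. w x = v x)"
proof
  assume "excursion w S"
  moreover have "excursion (restrict w S) S \<longleftrightarrow> excursion w S" by (rule excursion_cong) simp
  ultimately show "\<exists>v\<in>{v \<in> S \<rightarrow>\<^sub>E UNIV. excursion v S}. \<forall>x\<in>S. w x = v x"
    by (intro bexI[of _ "restrict w S"]) auto
next
  assume "\<exists>v\<in>{v \<in> S \<rightarrow>\<^sub>E UNIV. excursion v S}. \<forall>x\<in>S. w x = v x"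
  then obtain v where "excursion v S" "\<forall>x\<in>S. w x = v x" by blast
  then show "excursion w S" using excursion_cong[of S w v] by blast
qed

lemma finite_words: "finite S \<Longrightarrow> finite {v \<in> S \<rightarrow>\<^sub>E (UNIV :: letter set). Q v}"
  by (rule finite_subset[OF _ finite_PiE]) auto

text \<open>The index type is kept abstract, so that both words together form one independent family
  indexed by \<open>int + int\<close>; an injection \<open>e\<close> then selects one of
  them.\<close>

locale uniform_letters = prob_space M for M :: "'a measure" +
  fixes X :: "'i \<Rightarrow> 'a \<Rightarrow> letter"
  assumes indep: "indep_vars (\<lambda>_. count_space UNIV) X UNIV"
    and uniform: "\<And>i. distr M (count_space UNIV) (X i) = uniform_count_measure {L, R}"
begin

lemma random_X [measurable]: "X i \<in> measurable M (count_space UNIV)"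
  using indep by (simp add: indep_vars_def2)

lemma prob_letter: "prob (X i -` {c} \<inter> space M) = 1 / 2"
proof -
  have "prob (X i -` {c} \<inter> space M) = measure (distr M (count_space UNIV) (X i)) {c}"
    by (simp add: measure_distr)
  also have "\<dots> = 1 / 2"
  proof -
    have "{c} \<subseteq> {L, R}" by (cases c) auto
    then show ?thesis unfolding uniform by (subst measure_uniform_count_measure) simp_all
  qed
  finally show ?thesis .
qed

lemma prob_word:
  assumes "finite S" "S \<noteq> {}" "inj_on e S"
  shows "prob {\<omega> \<in> space M. \<forall>x\<in>S. X (e x) \<omega> = v x} = (1 / 2) ^ card S"
proof -
  have "{\<omega> \<in> space M. \<forall>x\<in>S. X (e x) \<omega> = v x} = (\<Inter>i\<in>e ` S. X i -` {v (inv_into S e i)} \<inter> space M)"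
    using assms by (auto simp: inv_into_f_f)
  also have "prob \<dots> = (\<Prod>i\<in>e ` S. prob (X i -` {v (inv_into S e i)} \<inter> space M))"
    using assms by (intro indep_varsD[OF indep]) auto
  also have "\<dots> = (1 / 2) ^ card S" using card_image[OF assms(3)] by (simp add: prob_letter)
  finally show ?thesis .
qed

lemma pred_excursion:
  assumes "finite S"
  shows "Measurable.pred M (\<lambda>\<omega>. excursion (\<lambda>x. X (e x) \<omega>) S)"
proof -
  have "Measurable.pred M (\<lambda>\<omega>. \<exists>v\<in>{v \<in> S \<rightarrow>\<^sub>E UNIV. excursion v S}. \<forall>x\<in>S. X (e x) \<omega> = v x)"
    using assms finite_words[OF assms] by (intro pred_intros_finite pred_eq_const1[where N = "count_space UNIV"]) auto
  then show ?thesis by (subst excursion_iff_ex_word)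
qed

text \<open>There are \<open>Cat_n\<close> disjoint cylinders, each of probability
  \<open>2^(-2n-2)\<close>; the factor 1/4 is what \<open>arc_weight\<close> omits.\<close>

lemma prob_excursion:
  assumes S: "finite S" "card S = 2 * n + 2" and e: "inj_on e S"
  shows "prob {\<omega> \<in> space M. excursion (\<lambda>x. X (e x) \<omega>) S} = arc_weight n / 4"
proof -
  define V where "V = {v \<in> S \<rightarrow>\<^sub>E (UNIV :: letter set). excursion v S}"
  define B where "B v = {\<omega> \<in> space M. \<forall>x\<in>S. X (e x) \<omega> = v x}" for v
  have V: "finite V" unfolding V_def by (rule finite_words[OF S(1)])
  have "S \<noteq> {}" using S by auto
  have "{\<omega> \<in> space M. excursion (\<lambda>x. X (e x) \<omega>) S} = (\<Union>v\<in>V. B v)"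
    by (subst excursion_iff_ex_word) (auto simp: V_def B_def)
  also have "prob \<dots> = (\<Sum>v\<in>V. prob (B v))"
  proof (rule finite_measure_finite_Union[OF V])
    show "B ` V \<subseteq> events"
    proof safe
      fix v
      have "Measurable.pred M (\<lambda>\<omega>. \<forall>x\<in>S. X (e x) \<omega> = v x)"
        using S(1) by (intro pred_intros_finite pred_eq_const1[where N = "count_space UNIV"]) auto
      then show "B v \<in> events" by (simp add: B_def pred_def)
    qed
    show "disjoint_family_on B V"
      unfolding disjoint_family_on_def
    proof (intro ballI impI)
      fix u v assume uv: "u \<in> V" "v \<in> V" "u \<noteq> v"
      then obtain x where "x \<in> S" "u x \<noteq> v x" using PiE_ext[of u S "\<lambda>_. UNIV" v] by (auto simp: V_def)
      then show "B u \<inter> B v = {}" by (auto simp: B_def)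
    qed
  qed
  also have "\<dots> = real (card V) * (1 / 2) ^ card S"
    unfolding B_def using prob_word[OF S(1) \<open>S \<noteq> {}\<close> e] by simp
  also have "\<dots> = catalan n * (1 / 2) ^ (2 * n + 2)"
    using card_excursion[OF S] S by (simp add: V_def)
  also have "\<dots> = arc_weight n / 4"
    by (simp add: arc_weight_eq power_add power_mult power_divide)
  finally show ?thesis .
qed

text \<open>The events look at disjoint blocks of letters, and blocks of an independent family are
  independent.\<close>

lemma prob_ball_excursion:
  fixes e :: "'j \<Rightarrow> int \<Rightarrow> 'i"
  assumes J: "finite J" "J \<noteq> {}" and S: "\<And>j. j \<in> J \<Longrightarrow> finite (S j)"
    and disj: "disjoint_family_on (\<lambda>j. e j ` S j) J"
  shows "prob {\<omega> \<in> space M. \<forall>j\<in>J. excursion (\<lambda>x. X (e j x) \<omega>) (S j)} =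
    (\<Prod>j\<in>J. prob {\<omega> \<in> space M. excursion (\<lambda>x. X (e j x) \<omega>) (S j)})"
proof -
  define K where "K j = e j ` S j" for j
  define Y where "Y j \<omega> = restrict (\<lambda>i. X i \<omega>) (K j)" for j \<omega>
  define A where "A j = {y \<in> K j \<rightarrow>\<^sub>E UNIV. excursion (\<lambda>x. y (e j x)) (S j)}" for j
  have ind: "indep_vars (\<lambda>j. PiM (K j) (\<lambda>_. count_space UNIV)) Y J"
    unfolding Y_def by (rule indep_vars_restrict[OF indep]) (use disj in \<open>auto simp: K_def\<close>)
  have pre: "Y j -` A j \<inter> space M = {\<omega> \<in> space M. excursion (\<lambda>x. X (e j x) \<omega>) (S j)}" for j
  proof -
    have "excursion (\<lambda>x. Y j \<omega> (e j x)) (S j) \<longleftrightarrow> excursion (\<lambda>x. X (e j x) \<omega>) (S j)" for \<omega>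
      by (rule excursion_cong) (auto simp: Y_def K_def)
    moreover have "Y j \<omega> \<in> K j \<rightarrow>\<^sub>E UNIV" for \<omega> by (simp add: Y_def)
    ultimately show ?thesis by (auto simp: A_def)
  qed
  have A: "A j \<in> sets (PiM (K j) (\<lambda>_. count_space UNIV))" if "j \<in> J" for j
  proof -
    have "finite (K j)" using S[OF that] by (simp add: K_def)
    \<comment> \<open>A block has finitely many letters, so its product space is discrete and every
      set of words is measurable.\<close>
    then have "PiM (K j) (\<lambda>_. count_space (UNIV :: letter set)) = count_space (K j \<rightarrow>\<^sub>E UNIV)"
      by (rule count_space_PiM_finite) (simp add: countable_finite)
    then show ?thesis by (auto simp: A_def)
  qed
  have "{\<omega> \<in> space M. \<forall>j\<in>J. excursion (\<lambda>x. X (e j x) \<omega>) (S j)} = (\<Inter>j\<in>J. Y j -` A j \<inter> space M)"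
    unfolding pre using J by auto
  also have "prob \<dots> = (\<Prod>j\<in>J. prob (Y j -` A j \<inter> space M))"
    by (rule indep_varsD_finite[OF ind J(2,1) A])
  finally show ?thesis by (simp only: pre)
qed

end

section \<open>Total mass of the excursion lengths\<close>

text \<open>The probability that a simple random walk is at 0 at time \<open>2n\<close>.\<close>

definition central :: "nat \<Rightarrow> real" where
  "central n = real ((2 * n) choose n) / 4 ^ n"

lemma central_Suc: "central (Suc n) = central n * (2 * real n + 1) / (2 * real n + 2)"
proof -
  have "Suc n * (2 * Suc n choose Suc n) = 2 * Suc n * (Suc (2 * n) choose n)"
    using binomial_absorption[of n "2 * Suc n"] by (simp del: binomial_Suc_Suc)
  then have "Suc n * (2 * Suc n choose Suc n) = Suc n * (2 * (Suc (2 * n) choose n))" by (simp only: mult_ac)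
  then have 1: "(2 * Suc n choose Suc n) = 2 * (Suc (2 * n) choose n)" by (simp only: Suc_mult_cancel1)
  have "Suc (2 * n) choose n = Suc (2 * n) choose Suc n"
    using binomial_symmetric[of n "Suc (2 * n)"] by simp
  moreover have "Suc n * (Suc (2 * n) choose Suc n) = Suc (2 * n) * ((2 * n) choose n)"
    using binomial_absorption[of n "Suc (2 * n)"] by (simp del: binomial_Suc_Suc)
  ultimately have 2: "Suc n * (Suc (2 * n) choose n) = Suc (2 * n) * ((2 * n) choose n)" by simp
  have "real (Suc n) * real (2 * Suc n choose Suc n) = 2 * real (Suc (2 * n)) * real ((2 * n) choose n)"
    unfolding 1 using arg_cong[OF 2, of real] by (simp only: of_nat_mult of_nat_numeral)
  then have "real (2 * Suc n choose Suc n) = 2 * real (Suc (2 * n)) * real ((2 * n) choose n) / real (Suc n)"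
    by (metis nonzero_mult_div_cancel_left of_nat_neq_0)
  moreover have "2 * real n + 1 = real (Suc (2 * n))" "2 * real n + 2 = 2 * real (Suc n)" by simp_all
  ultimately show ?thesis unfolding central_def power_Suc
    by (simp only:) (simp add: field_simps del: of_nat_Suc binomial_Suc_Suc)
qed

text \<open>A substitute for Stirling's formula. The factor \<open>2n + 1\<close> lets the induction
  close, because \<open>(2n+1)(2n+3) \<le> (2n+2)^2\<close>.\<close>

lemma central_bound: "(central n)\<^sup>2 * (2 * real n + 1) \<le> 1"
proof (induction n)
  case (Suc n)
  have "(central (Suc n))\<^sup>2 * (2 * real (Suc n) + 1) =
     ((central n)\<^sup>2 * (2 * real n + 1)) * ((2 * real n + 1) * (2 * real n + 3) / (2 * real n + 2)\<^sup>2)"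
    unfolding central_Suc by (simp add: field_simps power2_eq_square)
  also have "\<dots> \<le> 1 * 1"
  proof (rule mult_mono[OF Suc.IH])
    have "(2 * real n + 1) * (2 * real n + 3) \<le> (2 * real n + 2)\<^sup>2"
      by (simp add: power2_eq_square algebra_simps)
    then show "(2 * real n + 1) * (2 * real n + 3) / (2 * real n + 2)\<^sup>2 \<le> 1"
      by (simp add: divide_le_eq)
  qed auto
  finally show ?case by simp
qed (simp add: central_def)

lemma central_tendsto_0: "central \<longlonglongrightarrow> 0"
proof (rule Lim_null_comparison)
  show "\<forall>\<^sub>F n in sequentially. norm (central n) \<le> sqrt (inverse (2 * real n + 1))"
  proof (intro always_eventually allI)
    fix n
    have "(central n)\<^sup>2 \<le> inverse (2 * real n + 1)"
      using central_bound[of n] by (simp add: field_simps)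
    then show "norm (central n) \<le> sqrt (inverse (2 * real n + 1))"
      using real_sqrt_le_mono by fastforce
  qed
  have "(\<lambda>n. inverse (2 * real n + 1)) \<longlonglongrightarrow> 0"
    by (intro tendsto_inverse_0_at_top filterlim_at_top_mono[OF filterlim_real_sequentially]) auto
  then show "(\<lambda>n. sqrt (inverse (2 * real n + 1))) \<longlonglongrightarrow> 0"
    using tendsto_real_sqrt by fastforce
qed

text \<open>The sum telescopes: \<open>arc_weight n / 4\<close> is half the decrease from
  \<open>central n\<close> to \<open>central (Suc n)\<close>.\<close>

lemma sum_arc_weight: "(\<Sum>n<N. arc_weight n / 4) = (1 - central N) / 2"
proof (induction N)
  case (Suc N)
  have "arc_weight N / 4 = central N / (4 * (real N + 1))"
    by (simp add: arc_weight_eq catalan_def central_def field_simps)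
  moreover have "(1 - central (Suc N)) / 2 = (1 - central N) / 2 + central N / (4 * (real N + 1))"
    by (simp add: central_Suc field_simps)
  ultimately show ?case by (simp only: sum.lessThan_Suc Suc)
qed (simp add: central_def)

lemma arc_weight_sums: "(\<lambda>n. arc_weight n / 4) sums (1 / 2)"
proof -
  have "(\<lambda>N. (1 - central N) / 2) \<longlonglongrightarrow> (1 - 0) / 2" by (intro tendsto_intros central_tendsto_0) auto
  then show ?thesis unfolding sums_def sum_arc_weight by simp
qed

context uniform_letters
begin

text \<open>The event that some window carries an excursion is contained in the event that the
  letter at \<open>i\<close> is \<open>c\<close>. Both have probability 1/2, so they differ by a
  null set. The family \<open>S\<close> is generic to serve windows that start at \<open>i\<close>
  as well as windows that end there.\<close>

lemma AE_ex_excursion: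
  fixes S :: "nat \<Rightarrow> int set"
  assumes S: "\<And>n. finite (S n)" "\<And>n. card (S n) = 2 * n + 2" and e: "inj e"
    and imp: "\<And>w n. excursion w (S n) \<Longrightarrow> w i = c"
    and unique: "\<And>w m n. excursion w (S m) \<Longrightarrow> excursion w (S n) \<Longrightarrow> m = n"
  shows "AE \<omega> in M. X (e i) \<omega> = c \<longrightarrow> (\<exists>n. excursion (\<lambda>x. X (e x) \<omega>) (S n))"
proof -
  define A where "A = X (e i) -` {c} \<inter> space M"
  define B where "B n = {\<omega> \<in> space M. excursion (\<lambda>x. X (e x) \<omega>) (S n)}" for n
  have B: "B n \<in> events" for n using pred_excursion[OF S(1)] by (simp add: B_def pred_def)
  have A: "A \<in> events" unfolding A_def by measurable
  have "(\<lambda>n. prob (B n)) sums prob (\<Union>n. B n)"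
    using B unique by (intro finite_measure_UNION) (auto simp: disjoint_family_on_def B_def)
  moreover have "prob (B n) = arc_weight n / 4" for n
    unfolding B_def using e by (intro prob_excursion[OF S]) (rule inj_on_subset, auto)
  ultimately have "(\<lambda>n. arc_weight n / 4) sums prob (\<Union>n. B n)" by (simp only:)
  then have "prob (\<Union>n. B n) = 1 / 2" using arc_weight_sums by (rule sums_unique2)
  moreover have "(\<Union>n. B n) \<subseteq> A"
    using imp[of "\<lambda>x. X (e x) \<omega>" for \<omega>] by (auto simp: A_def B_def)
  ultimately have "prob (A - (\<Union>n. B n)) = 0"
    using A B finite_measure_Diff[OF A] by (simp add: A_def prob_letter)
  then have "AE \<omega> in M. \<omega> \<notin> A - (\<Union>n. B n)"
    using A B by (intro AE_not_in) (auto simp: null_sets_def emeasure_eq_measure)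
  then show ?thesis
    by (rule AE_mp) (auto simp: A_def B_def)
qed

lemma AE_matched_word:
  assumes e: "inj e"
  shows "AE \<omega> in M. matched_word (\<lambda>x. X (e x) \<omega>)"
proof -
  have "AE \<omega> in M. X (e i) \<omega> = L \<longrightarrow> (\<exists>n. excursion (\<lambda>x. X (e x) \<omega>) {i..i + 2 * int n + 1})" for i
  proof (rule AE_ex_excursion[OF _ _ e])
    show "w i = L" if "excursion w {i..i + 2 * int n + 1}" for w n
      using excursion_first[of w UNIV i "i + 2 * int n + 1"] that by simp
    show "m = n" if "excursion w {i..i + 2 * int m + 1}" "excursion w {i..i + 2 * int n + 1}" for w m n
      using excursion_right_unique[of w UNIV i "i + 2 * int m + 1" "i + 2 * int n + 1"]
        excursion_right_unique[of w UNIV i "i + 2 * int n + 1" "i + 2 * int m + 1"] that by simp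
  qed auto
  moreover have "AE \<omega> in M. X (e i) \<omega> = R \<longrightarrow> (\<exists>n. excursion (\<lambda>x. X (e x) \<omega>) {i - (2 * int n + 1)..i})" for i
  proof (rule AE_ex_excursion[OF _ _ e])
    show "w i = R" if "excursion w {i - (2 * int n + 1)..i}" for w n
      using excursion_last[OF that] by simp
    show "m = n" if "excursion w {i - (2 * int m + 1)..i}" "excursion w {i - (2 * int n + 1)..i}" for w m n
      using excursion_left_unique[of w UNIV "i - (2 * int m + 1)" i "i - (2 * int n + 1)"]
        excursion_left_unique[of w UNIV "i - (2 * int n + 1)" i "i - (2 * int m + 1)"] that by simp
  qed auto
  ultimately have "AE \<omega> in M. \<forall>i. (X (e i) \<omega> = L \<longrightarrow> (\<exists>n. excursion (\<lambda>x. X (e x) \<omega>) {i..i + 2 * int n + 1})) \<and>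
      (X (e i) \<omega> = R \<longrightarrow> (\<exists>n. excursion (\<lambda>x. X (e x) \<omega>) {i - (2 * int n + 1)..i}))"
    by (simp add: AE_all_countable)
  then show ?thesis
  proof (rule AE_mp, intro AE_I2 impI)
    fix \<omega>
    assume *: "\<forall>i. (X (e i) \<omega> = L \<longrightarrow> (\<exists>n. excursion (\<lambda>x. X (e x) \<omega>) {i..i + 2 * int n + 1})) \<and>
      (X (e i) \<omega> = R \<longrightarrow> (\<exists>n. excursion (\<lambda>x. X (e x) \<omega>) {i - (2 * int n + 1)..i}))"
    show "matched_word (\<lambda>x. X (e x) \<omega>)"
      unfolding matched_word_def
    proof (intro allI conjI impI)
      fix i
      show "\<exists>j>i. excursion (\<lambda>x. X (e x) \<omega>) {i..j}" if "X (e i) \<omega> = L"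
      proof -
        obtain n where "excursion (\<lambda>x. X (e x) \<omega>) {i..i + 2 * int n + 1}" using * \<open>X (e i) \<omega> = L\<close> by blast
        then show ?thesis by (intro exI[of _ "i + 2 * int n + 1"]) simp
      qed
      show "\<exists>j<i. excursion (\<lambda>x. X (e x) \<omega>) {j..i}" if "X (e i) \<omega> = R"
      proof -
        obtain n where "excursion (\<lambda>x. X (e x) \<omega>) {i - (2 * int n + 1)..i}" using * \<open>X (e i) \<omega> = R\<close> by blast
        then show ?thesis by (intro exI[of _ "i - (2 * int n + 1)"]) simp
      qed
    qed
  qed
qed

lemma pred_matched_word: "Measurable.pred M (\<lambda>\<omega>. matched_word (\<lambda>x. X (e x) \<omega>))"
proof -
  have [measurable]: "Measurable.pred M (\<lambda>\<omega>. excursion (\<lambda>x. X (e x) \<omega>) {i..j})" for i j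
    by (rule pred_excursion) simp
  show ?thesis unfolding matched_word_def by measurable
qed

lemma pred_linked:
  assumes "noncrossing_matching {0..<n} P"
  shows "Measurable.pred M (\<lambda>\<omega>. linked (\<lambda>x. X (e x) \<omega>) f P)"
proof -
  have "finite (arcs P)" using arcs_subset[OF assms] by (rule finite_subset) simp
  then show ?thesis
    unfolding linked_def case_prod_beta by (intro pred_intros_finite pred_excursion) auto
qed

end

lemma card_arcs:
  assumes P: "noncrossing_matching {0..<2 * k} P"
  shows "card (arcs P) = k"
proof -
  have part: "partition_on {0..<2 * k} P" and two: "\<And>p. p \<in> P \<Longrightarrow> card p = 2"
    using P by (auto simp: noncrossing_matching_def)
  have "2 * k = card (\<Union>P)" using noncrossing_matching_Union[OF P] by simp
  also have "\<dots> = sum card P"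
    using part two by (intro card_Union_disjoint) (auto simp: partition_on_def card_ge_0_finite)
  also have "\<dots> = 2 * card P" using two by simp
  finally have "card P = k" by simp
  moreover have "bij_betw (\<lambda>(a, b). {a, b}) (arcs P) P"
    unfolding bij_betw_def
  proof
    show "inj_on (\<lambda>(a, b). {a, b}) (arcs P)"
      by (auto simp: inj_on_def arcs_def doubleton_eq_iff)
    show "(\<lambda>(a, b). {a, b}) ` arcs P = P"
    proof
      show "P \<subseteq> (\<lambda>(a, b). {a, b}) ` arcs P"
      proof
        fix p assume p: "p \<in> P"
        then obtain x y where xy: "p = {x, y}" using two by (metis card_2_iff)
        then have "(x, y) \<in> arcs P \<or> (y, x) \<in> arcs P" using matching_pair_arcs[OF P] p by simp
        then show "p \<in> (\<lambda>(a, b). {a, b}) ` arcs P" using xy by (auto simp: insert_commute)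
      qed
    qed (auto simp: arcs_def)
  qed
  ultimately show ?thesis by (simp add: bij_betw_same_card)
qed

text \<open>Countable additivity as an unordered sum; the index set will be the gap vectors, which
  are not indexed by naturals.\<close>

lemma (in finite_measure) has_sum_measure_UN:
  assumes I: "countable I" and A: "\<And>i. i \<in> I \<Longrightarrow> A i \<in> sets M" "disjoint_family_on A I"
  shows "((\<lambda>i. measure M (A i)) has_sum measure M (\<Union>i\<in>I. A i)) I"
proof (cases "finite I")
  case True
  then show ?thesis
    using finite_measure_finite_Union[OF True _ A(2)] A(1) by (auto intro!: has_sum_finiteI)
next
  case False
  let ?h = "from_nat_into I"
  have bij: "bij_betw ?h UNIV I" using I False by (rule bij_betw_from_nat_into)
  have "(\<lambda>n. measure M (A (?h n))) sums measure M (\<Union>n. A (?h n))"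
  proof (rule finite_measure_UNION)
    show "range (\<lambda>n. A (?h n)) \<subseteq> sets M" using A(1) bij by (auto simp: bij_betw_def)
    show "disjoint_family (\<lambda>n. A (?h n))"
      using A(2) bij unfolding disjoint_family_on_def bij_betw_def by (metis UNIV_I injD rangeI)
  qed
  then have "((\<lambda>n. measure M (A (?h n))) has_sum measure M (\<Union>n. A (?h n))) UNIV"
    by (rule sums_nonneg_imp_has_sum) simp
  moreover have "(\<Union>n. A (?h n)) = \<Union>(A ` range ?h)" by blast
  moreover have "range ?h = I" using bij by (simp add: bij_betw_def)
  ultimately have "((\<lambda>n. measure M (A (?h n))) has_sum measure M (\<Union>i\<in>I. A i)) UNIV" by (simp only:)
  then show ?thesis using has_sum_reindex_bij_betw[OF bij, of "\<lambda>i. measure M (A i)"] by (simp only:)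
qed


section \<open>Probability of a realisation and summation\<close>

text \<open>The excursion events of all faces, upper and lower, are independent and depend on the
  gaps only through the face sizes; hence \<open>m\<close> disappears from the value.\<close>

lemma prob_linked:
  fixes wa wb :: "int \<Rightarrow> 'a \<Rightarrow> letter"
  assumes X: "uniform_letters M (case_sum wa wb)" and k: "k \<ge> 1"
    and nc: "noncrossing_matching {0..<2 * k} (fst C)" "noncrossing_matching {0..<2 * k} (snd C)"
  shows "measure M {\<omega> \<in> space M. linked (\<lambda>i. wa i \<omega>) (pos m l) (fst C) \<and> linked (\<lambda>i. wb i \<omega>) (pos m l) (snd C)} =
    face_weight k C l / 16 ^ k"
proof -
  interpret uniform_letters M "case_sum wa wb" by (rule X)
  interpret A: gap_map "2 * k" "fst C" "pos m l" by unfold_locales (use nc strict_mono_pos in auto)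
  interpret B: gap_map "2 * k" "snd C" "pos m l" by unfold_locales (use nc strict_mono_pos in auto)
  define J where "J = arcs (fst C) <+> arcs (snd C)"
  define e :: "(nat \<times> nat) + (nat \<times> nat) \<Rightarrow> int \<Rightarrow> int + int" where "e j = (case j of Inl _ \<Rightarrow> Inl | Inr _ \<Rightarrow> Inr)" for j
  define S where "S j = (case j of Inl p \<Rightarrow> arc_points (pos m l) (arcs (fst C)) p
    | Inr p \<Rightarrow> arc_points (pos m l) (arcs (snd C)) p)" for j
  have card: "card (arcs (fst C)) = k" "card (arcs (snd C)) = k" using card_arcs nc by auto
  have J: "finite J" using A.finite_U B.finite_U by (simp add: J_def)
  have "J \<noteq> {}" using card(1) k by (auto simp: J_def)
  have S: "finite (S j)" if "j \<in> J" for j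
    using that A.finite_arc_points B.finite_arc_points by (auto simp: J_def S_def)
  have disj: "disjoint_family_on (\<lambda>j. e j ` S j) J"
    unfolding disjoint_family_on_def
  proof (intro ballI impI)
    fix i j assume "i \<in> J" "j \<in> J" "i \<noteq> j"
    then show "e i ` S i \<inter> e j ` S j = {}"
      using A.arc_points_disjoint B.arc_points_disjoint
      by (cases i; cases j) (fastforce simp: J_def e_def S_def)+
  qed
  have "linked (\<lambda>i. wa i \<omega>) (pos m l) (fst C) \<and> linked (\<lambda>i. wb i \<omega>) (pos m l) (snd C) \<longleftrightarrow>
      (\<forall>j\<in>J. excursion (\<lambda>x. case_sum wa wb (e j x) \<omega>) (S j))" for \<omega>
    unfolding linked_def A.excursions_iff B.excursions_iff
    by (simp add: J_def Plus_def ball_Un e_def S_def)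
  then have "prob {\<omega> \<in> space M. linked (\<lambda>i. wa i \<omega>) (pos m l) (fst C) \<and> linked (\<lambda>i. wb i \<omega>) (pos m l) (snd C)} =
      (\<Prod>j\<in>J. prob {\<omega> \<in> space M. excursion (\<lambda>x. case_sum wa wb (e j x) \<omega>) (S j)})"
    using prob_ball_excursion[OF J \<open>J \<noteq> {}\<close> S disj] by simp
  also have "\<dots> = (\<Prod>p\<in>arcs (fst C). prob {\<omega> \<in> space M. excursion (\<lambda>x. case_sum wa wb (Inl x) \<omega>) (arc_points (pos m l) (arcs (fst C)) p)}) *
      (\<Prod>p\<in>arcs (snd C). prob {\<omega> \<in> space M. excursion (\<lambda>x. case_sum wa wb (Inr x) \<omega>) (arc_points (pos m l) (arcs (snd C)) p)})"
    unfolding J_def by (subst prod.Plus[OF A.finite_U B.finite_U]) (simp add: e_def S_def)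
  also have "\<dots> = (\<Prod>p\<in>arcs (fst C). arc_weight (\<Sum>i\<in>visible (arcs (fst C)) p. l i) / 4) *
      (\<Prod>p\<in>arcs (snd C). arc_weight (\<Sum>i\<in>visible (arcs (snd C)) p. l i) / 4)"
    by (intro arg_cong2[where f = "(*)"] prod.cong refl prob_excursion A.finite_arc_points B.finite_arc_points
        A.card_arc_points B.card_arc_points pos_Suc) auto
  \<comment> \<open>Each of the \<open>k\<close> upper and \<open>k\<close> lower faces contributes
    a factor 1/4.\<close>
  also have "\<dots> = face_weight k C l / 16 ^ k"
    unfolding prod_dividef face_weight_eq[OF nc] prod_constant card
    by (simp flip: power_mult_distrib)
  finally show ?thesis .
qed

theorem proposition10:
  fixes M :: "'a measure" and wa wb :: "int \<Rightarrow> 'a \<Rightarrow> letter"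
    and k :: nat and C :: "nat set set \<times> nat set set"
  assumes "prob_space M"
    and "prob_space.indep_vars M (\<lambda>_. count_space UNIV) (case_sum wa wb) UNIV"
    and "\<And>i. distr M (count_space UNIV) (wa i) = uniform_count_measure {L, R}"
    and "\<And>i. distr M (count_space UNIV) (wb i) = uniform_count_measure {L, R}"
    and "k \<ge> 1" and "meander k C"
  shows "face_weight k C summable_on ({0..2 * k - 2} \<rightarrow>\<^sub>E UNIV) \<and>
    measure M {\<omega> \<in> space M. noodle_shape (\<lambda>i. wa i \<omega>) (\<lambda>i. wb i \<omega>) C} =
      2 powi (- 4 * int k + 1) * real k *
      (\<Sum>\<^sub>\<infinity>l\<in>{0..2 * k - 2} \<rightarrow>\<^sub>E UNIV. face_weight k C l)"
proof -
  have distr: "distr M (count_space UNIV) (case_sum wa wb i) = uniform_count_measure {L, R}" for i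
    using assms(3,4) by (cases i) auto
  interpret prob_space M by (rule assms(1))
  have UL: "uniform_letters M (case_sum wa wb)"
    by unfold_locales (fact assms(2) distr)+
  interpret uniform_letters M "case_sum wa wb" by (rule UL)
  have nc: "noncrossing_matching {0..<2 * k} (fst C)" "noncrossing_matching {0..<2 * k} (snd C)"
    using assms(6) by (auto simp: meander_def meandric_system_def)
  define \<Lambda> where "\<Lambda> = ({0..2 * k - 2} \<rightarrow>\<^sub>E (UNIV :: nat set))"
  \<comment> \<open>The shape event requires both matchings to exist. Intersecting with
    \<open>N\<close> accounts for this and costs no probability.\<close>
  define N where "N = {\<omega> \<in> space M. matched_word (\<lambda>i. wa i \<omega>) \<and> matched_word (\<lambda>i. wb i \<omega>)}"
  define D where "D m l = {\<omega> \<in> space M. linked (\<lambda>i. wa i \<omega>) (pos m l) (fst C) \<and> linked (\<lambda>i. wb i \<omega>) (pos m l) (snd C)}" for m l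
  note meas = pred_matched_word[of Inl, simplified] pred_matched_word[of Inr, simplified]
  have N: "N \<in> events" unfolding N_def using meas by measurable
  have D: "D m l \<in> events" for m l
    using pred_linked[OF nc(1), of Inl "pos m l"] pred_linked[OF nc(2), of Inr "pos m l"]
    unfolding D_def by (simp add: sets.sets_Collect_conj pred_def)
  have "AE \<omega> in M. matched_word (\<lambda>i. wa i \<omega>)" "AE \<omega> in M. matched_word (\<lambda>i. wb i \<omega>)"
    using AE_matched_word[of Inl] AE_matched_word[of Inr] by (simp_all add: inj_def)
  then have AE_N: "AE \<omega> in M. \<omega> \<in> N" using AE_space by eventually_elim (auto simp: N_def)
  have prob_D: "prob (N \<inter> D m l) = face_weight k C l / 16 ^ k" for m l
  proof -
    have "prob (N \<inter> D m l) = prob (D m l)"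
      using N D AE_N by (intro finite_measure_eq_AE) (auto elim!: eventually_mono)
    also have "\<dots> = face_weight k C l / 16 ^ k"
      unfolding D_def by (rule prob_linked[OF UL assms(5) nc])
    finally show ?thesis .
  qed
  have unique: "m = m' \<and> l = l'" if "m < 2 * k" "m' < 2 * k" "l \<in> \<Lambda>" "l' \<in> \<Lambda>" "\<omega> \<in> N" "\<omega> \<in> D m l" "\<omega> \<in> D m' l'" for m m' l l' \<omega>
    by (rule linked_pos_unique[OF assms(5,6), of "\<lambda>i. wa i \<omega>" "\<lambda>i. wb i \<omega>"])
      (use that in \<open>auto simp: N_def D_def \<Lambda>_def\<close>)
  have count: "countable \<Lambda>" unfolding \<Lambda>_def by (intro countable_PiE) auto
  have row: "((\<lambda>l. face_weight k C l / 16 ^ k) has_sum prob (\<Union>l\<in>\<Lambda>. N \<inter> D m l)) \<Lambda>" if m: "m < 2 * k" for m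
  proof -
    have "disjoint_family_on (\<lambda>l. N \<inter> D m l) \<Lambda>"
      unfolding disjoint_family_on_def using unique[OF m m] by blast
    then show ?thesis
      using has_sum_measure_UN[OF count, of "\<lambda>l. N \<inter> D m l"] N D by (simp add: prob_D)
  qed
  \<comment> \<open>Any \<open>m\<close> would do to obtain summability; 0 is admissible because
    \<open>k\<close> is positive.\<close>
  have "((\<lambda>l. 16 ^ k * (face_weight k C l / 16 ^ k)) has_sum (16 ^ k * prob (\<Union>l\<in>\<Lambda>. N \<inter> D 0 l))) \<Lambda>"
    using assms(5) by (intro has_sum_cmult_right row) simp
  then have hs: "(face_weight k C has_sum (16 ^ k * prob (\<Union>l\<in>\<Lambda>. N \<inter> D 0 l))) \<Lambda>" by simp
  then have summable: "face_weight k C summable_on \<Lambda>" by (rule has_sum_imp_summable)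
  have row': "prob (\<Union>l\<in>\<Lambda>. N \<inter> D m l) = (\<Sum>\<^sub>\<infinity>l\<in>\<Lambda>. face_weight k C l) / 16 ^ k" if "m < 2 * k" for m
    using infsumI[OF row[OF that]] infsum_cmult_left[of "1 / 16 ^ k" "face_weight k C" \<Lambda>] summable by simp
  \<comment> \<open>\<open>m\<close> is the rank of 0 among the points of its component.\<close>
  have "{\<omega> \<in> space M. noodle_shape (\<lambda>i. wa i \<omega>) (\<lambda>i. wb i \<omega>) C} = (\<Union>m\<in>{..<2 * k}. \<Union>l\<in>\<Lambda>. N \<inter> D m l)"
    unfolding noodle_shape_iff[OF assms(5,6)] by (auto simp: N_def D_def \<Lambda>_def)
  also have "prob \<dots> = (\<Sum>m<2 * k. prob (\<Union>l\<in>\<Lambda>. N \<inter> D m l))"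
  proof (rule finite_measure_finite_Union)
    show "(\<lambda>m. \<Union>l\<in>\<Lambda>. N \<inter> D m l) ` {..<2 * k} \<subseteq> events"
      using N D count by (auto intro!: sets.countable_UN')
    show "disjoint_family_on (\<lambda>m. \<Union>l\<in>\<Lambda>. N \<inter> D m l) {..<2 * k}"
      unfolding disjoint_family_on_def using unique by blast
  qed simp
  also have "\<dots> = real (2 * k) * ((\<Sum>\<^sub>\<infinity>l\<in>\<Lambda>. face_weight k C l) / 16 ^ k)"
  proof -
    have "(\<Sum>m<2 * k. prob (\<Union>l\<in>\<Lambda>. N \<inter> D m l)) = (\<Sum>m<2 * k. (\<Sum>\<^sub>\<infinity>l\<in>\<Lambda>. face_weight k C l) / 16 ^ k)"
      by (intro sum.cong refl row') simp
    then show ?thesis by simp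
  qed
  \<comment> \<open>The \<open>2 * k\<close> ranks have equal probability, and
    \<open>2 / 16^k = 2^(1-4k)\<close>.\<close>
  also have "\<dots> = 2 powi (- 4 * int k + 1) * real k * (\<Sum>\<^sub>\<infinity>l\<in>\<Lambda>. face_weight k C l)"
  proof -
    have "- 4 * int k = - int (4 * k)" by simp
    then have "(2::real) powi (- 4 * int k) = inverse (2 ^ (4 * k))"
      by (simp only: power_int_minus power_int_of_nat)
    moreover have "(2::real) powi (- 4 * int k + 1) = 2 powi (- 4 * int k) * 2 powi 1"
      by (rule power_int_add) simp
    ultimately have "(2::real) powi (- 4 * int k + 1) = 2 / 16 ^ k"
      by (simp only: power_mult) (simp add: divide_inverse)
    then show ?thesis by simp
  qed
  finally show ?thesis using summable unfolding \<Lambda>_def by blast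
qed

end
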